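(* For $n\ge1$ let $d_n$ be the number of (unlabeled) semiorders with $n$ points whose dimension is at most $2$. Then the ordinary generating function $D(x)=\sum_{n\ge1}d_nx^n$ is $$D(x) = \frac{-5x^8 + 41x^7 - 101x^6 + 129x^5 - 96x^4 + 42x^3 - 10x^2 + x}{7x^8 - 66x^7 + 197x^6 - 311x^5 + 294x^4 - 172x^3 + 61x^2 - 12x + 1}.$$
   Context: Unlabeled means counted up to isomorphism. All posets are finite and nonempty. A poset $P=(X,\le_P)$ is a semiorder if each $x\in X$ can be assigned a closed bounded real interval $[\ell(x),r(x)]$, all intervals of the same length, so that $x<_P y$ iff $r(x)<\ell(y)$. The dimension $\dim(P)$ is the least $d$ such that $\le_P$ is the intersection of $d$ linear extensions of $P$. *)

theory Defs
  imports "HOL-Computational_Algebra.Computational_Algebra"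
begin

text \<open>A poset is a carrier set together with its reflexive order relation, as in the
  library's \<^const>\<open>partial_order_on\<close>.\<close>

definition finite_poset :: "'a set \<Rightarrow> 'a rel \<Rightarrow> bool" where
  "finite_poset X r \<longleftrightarrow> finite X \<and> X \<noteq> {} \<and> partial_order_on X r"

definition semiorder :: "'a set \<Rightarrow> 'a rel \<Rightarrow> bool" where
  "semiorder X r \<longleftrightarrow> finite_poset X r \<and>
     (\<exists>(lo :: 'a \<Rightarrow> real) (hi :: 'a \<Rightarrow> real) (len :: real).
        (\<forall>x\<in>X. lo x \<le> hi x \<and> hi x - lo x = len) \<and>
        (\<forall>x\<in>X. \<forall>y\<in>X. ((x, y) \<in> r \<and> x \<noteq> y) \<longleftrightarrow> hi x < lo y))"

definition linear_extension :: "'a set \<Rightarrow> 'a rel \<Rightarrow> 'a rel \<Rightarrow> bool" where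
  "linear_extension X r L \<longleftrightarrow> linear_order_on X L \<and> r \<subseteq> L"

text \<open>A realizer is required to be nonempty, so a one-point poset has dimension 1 (not 0).
  The condition \<open>dimension \<le> 2\<close> does not depend on this convention.\<close>

definition realizer :: "'a set \<Rightarrow> 'a rel \<Rightarrow> 'a rel set \<Rightarrow> bool" where
  "realizer X r R \<longleftrightarrow> finite R \<and> R \<noteq> {} \<and> (\<forall>L\<in>R. linear_extension X r L) \<and> \<Inter>R = r"

definition poset_dim :: "'a set \<Rightarrow> 'a rel \<Rightarrow> nat" where
  "poset_dim X r = (LEAST d. \<exists>R. realizer X r R \<and> card R = d)"

definition poset_isomorphic :: "'a set \<Rightarrow> 'a rel \<Rightarrow> 'b set \<Rightarrow> 'b rel \<Rightarrow> bool" where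
  "poset_isomorphic X r Y s \<longleftrightarrow>
     (\<exists>f. bij_betw f X Y \<and> (\<forall>x\<in>X. \<forall>y\<in>X. (x, y) \<in> r \<longleftrightarrow> (f x, f y) \<in> s))"

text \<open>Every poset with \<open>n\<close> points is isomorphic to one with carrier \<open>{..<n}\<close>, so unlabeled
  posets are counted as isomorphism classes of orders on that carrier.\<close>

definition semiorders_dim_le_2 :: "nat \<Rightarrow> nat rel set" where
  "semiorders_dim_le_2 n = {r. semiorder {..<n} r \<and> poset_dim {..<n} r \<le> 2}"

definition iso_rel :: "nat \<Rightarrow> nat rel rel" where
  "iso_rel n = {(r, s). r \<in> semiorders_dim_le_2 n \<and> s \<in> semiorders_dim_le_2 n \<and>
     poset_isomorphic {..<n} r {..<n} s}"

definition num_semiorders_dim_le_2 :: "nat \<Rightarrow> nat" where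
  "num_semiorders_dim_le_2 n = card (semiorders_dim_le_2 n // iso_rel n)"

definition D_series :: "rat fps" where
  "D_series = Abs_fps (\<lambda>n. if n = 0 then 0 else of_nat (num_semiorders_dim_le_2 n))"

end

theory Submission
  imports Defs "HOL-Library.Product_Lexorder"
begin

text \<open>Sort the points of a semiorder by left endpoint. Counting, along this order, the left
  endpoints that are preceded by a new right endpoint (\<open>u\<close>) and vice versa (\<open>d\<close>) gives a
  representation by integer intervals \<open>[u, d]\<close> whose two ends are weakly increasing with
  increments at most 1. So unlabeled semiorders with \<open>n\<close> points correspond to words
  of \<open>n - 1\<close> steps in \<open>{0,1}\<^sup>2\<close> (two-coloured Motzkin paths).

  If \<open>x\<close>, \<open>y\<close>, \<open>z\<close> satisfy \<open>x < z\<close> and \<open>y\<close> is incomparable to both, then in a realizer of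
  size 2 the first linear order reverses exactly one of the pairs \<open>(x, y)\<close> and \<open>(y, z)\<close>. This
  yields a 2-colouring of the intervals in which intervals that cross (meet without
  containing each other, no end in common) get different colours. Conversely, such a colouring
  gives a realizer: the first order puts the intervals of one colour at their left and those of
  the other colour at their right end, the second order does the opposite. Hence the dimension
  is at most 2 iff the crossing graph is bipartite.

  A word whose crossing graph is bipartite is very restricted at height \<open>d - u \<ge> 2\<close>: after
  a rise it must descend straight to height 1. So bipartiteness is recognised by an automaton
  with one counter, and the generating functions of its states satisfy a linear system.\<close>

section \<open>Dimension and colourings of the crossing graph\<close>

text \<open>Oriented from left to right. Touching in one point (\<open>fst q = snd p\<close>) counts
  because the intervals are closed; a common left end or a common right end does not.\<close>

definition crossing :: "nat \<times> nat \<Rightarrow> nat \<times> nat \<Rightarrow> bool" where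
  "crossing p q \<longleftrightarrow> fst p < fst q \<and> fst q \<le> snd p \<and> snd p < snd q"

definition proper_colouring :: "(nat \<times> nat \<Rightarrow> bool) \<Rightarrow> (nat \<times> nat) set \<Rightarrow> bool" where
  "proper_colouring c S \<longleftrightarrow> (\<forall>p\<in>S. \<forall>q\<in>S. crossing p q \<longrightarrow> c p \<noteq> c q)"

section \<open>From a realizer of size two to a proper colouring\<close>

definition interval_order :: "'a set \<Rightarrow> ('a \<Rightarrow> nat) \<Rightarrow> ('a \<Rightarrow> nat) \<Rightarrow> 'a rel" where
  "interval_order X u d = {(x, y). x \<in> X \<and> y \<in> X \<and> (x = y \<or> d x < u y)}"

text \<open>A point is coloured by whether \<open>L1\<close> puts it above a chosen point \<alpha> x
  whose interval ends where that of x starts. For a crossing pair i, j take g starting where j ends: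
  alternation along \<alpha> i, i, j, g and along \<alpha> j, j, g makes the colours opposite. The
  hypothesis \<open>img\<close> supplies \<alpha> and g.\<close>

lemma realizer_imp_proper:
  assumes L1: "linear_order_on X L1" and L2: "linear_order_on X L2"
    and meet: "L1 \<inter> L2 = interval_order X u d"
    and le: "\<And>x. x \<in> X \<Longrightarrow> u x \<le> d x" and img: "u ` X = d ` X"
  shows "\<exists>c. proper_colouring c ((\<lambda>x. (u x, d x)) ` X)"
proof -
  define inc where "inc x y \<longleftrightarrow> x \<in> X \<and> y \<in> X \<and> x \<noteq> y \<and> u y \<le> d x \<and> u x \<le> d y" for x y
  define bel where "bel x y \<longleftrightarrow> x \<in> X \<and> y \<in> X \<and> d x < u y" for x y
  have tot: "(x, y) \<in> L \<or> (y, x) \<in> L" if "x \<in> X" "y \<in> X" "x \<noteq> y" "linear_order_on X L" for x y L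
    using that by (auto simp: linear_order_on_def total_on_def)
  have tr: "(x, z) \<in> L" if "(x, y) \<in> L" "(y, z) \<in> L" "linear_order_on X L" for x y z L
    using that by (meson linear_order_on_def partial_order_on_def preorder_on_def transE)
  have as: False if "(x, y) \<in> L" "(y, x) \<in> L" "x \<noteq> y" "linear_order_on X L" for x y L
    using that by (meson linear_order_on_def partial_order_on_def antisymD)
  have opp: "(y, x) \<in> L2 \<longleftrightarrow> (x, y) \<in> L1" if "inc x y" for x y
  proof -
    have "(x, y) \<notin> L1 \<inter> L2" "(y, x) \<notin> L1 \<inter> L2"
      using that by (auto simp: meet interval_order_def inc_def)
    then show ?thesis
      using that tot[OF _ _ _ L1, of x y] tot[OF _ _ _ L2, of x y] as[OF _ _ _ L1, of x y] as[OF _ _ _ L2, of x y]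
      unfolding inc_def by blast
  qed
  \<comment> \<open>If \<open>L1\<close> kept both pairs, \<open>L2\<close> would reverse both and
    so put z below x; if \<open>L1\<close> reversed both, it would itself put z below x.\<close>
  have alt: "(x, y) \<in> L1 \<longleftrightarrow> (y, z) \<notin> L1" if xy: "inc x y" and yz: "inc y z" and xz: "bel x z" for x y z
  proof
    have xz': "(x, z) \<in> L1" "(x, z) \<in> L2"
      using xz meet by (auto simp: interval_order_def bel_def)
    have ne: "x \<noteq> z" using xz le[of x] by (auto simp: bel_def)
    show "(y, z) \<notin> L1" if "(x, y) \<in> L1"
      using that opp[OF xy] opp[OF yz] tr[OF _ _ L2] as[OF xz'(2) _ ne L2] by blast
    show "(x, y) \<in> L1" if "(y, z) \<notin> L1"
    proof (rule ccontr)
      assume "(x, y) \<notin> L1"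
      then have "(y, x) \<in> L1" "(z, y) \<in> L1"
        using tot[OF _ _ _ L1] xy yz that by (auto simp: inc_def)
      then show False using tr[OF _ _ L1] as[OF xz'(1) _ ne L1] by blast
    qed
  qed
  have "\<forall>x. \<exists>y. x \<in> X \<longrightarrow> y \<in> X \<and> d y = u x"
    using img by (metis imageE imageI)
  then obtain \<alpha> where \<alpha>: "\<And>x. x \<in> X \<Longrightarrow> \<alpha> x \<in> X \<and> d (\<alpha> x) = u x" by metis
  define s where "s x \<longleftrightarrow> (\<alpha> x, x) \<in> L1" for x
  have s: "s i \<noteq> s j" if ij: "i \<in> X" "j \<in> X" "u i < u j" "u j \<le> d i" "d i < d j" for i j
  proof -
    obtain g where g: "g \<in> X" "u g = d j" using img ij(2) by (metis imageE imageI)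
    note a = \<alpha>[OF ij(1)] \<alpha>[OF ij(2)]
    note l = le[OF ij(1)] le[OF ij(2)] le[OF g(1)] le[of "\<alpha> i"] le[of "\<alpha> j"]
    have "inc (\<alpha> i) i" "inc i j" "bel (\<alpha> i) j" "inc j g" "bel i g" "inc (\<alpha> j) j" "bel (\<alpha> j) g"
      using a l g ij by (auto simp: inc_def bel_def)
    then show ?thesis using alt unfolding s_def by blast
  qed
  \<comment> \<open>Points with the same interval may differ in \<open>s\<close>, but the claim
    about \<open>s\<close> covers all points with crossing intervals, so any representative will
    do.\<close>
  define c where "c p = s (SOME x. x \<in> X \<and> (u x, d x) = p)" for p
  have "c p \<noteq> c q" if p: "p \<in> (\<lambda>x. (u x, d x)) ` X" and q: "q \<in> (\<lambda>x. (u x, d x)) ` X" and pq: "crossing p q" for p q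
  proof -
    define i where "i = (SOME x. x \<in> X \<and> (u x, d x) = p)"
    define j where "j = (SOME x. x \<in> X \<and> (u x, d x) = q)"
    have i: "i \<in> X \<and> (u i, d i) = p" unfolding i_def by (rule someI_ex) (use p in auto)
    have j: "j \<in> X \<and> (u j, d j) = q" unfolding j_def by (rule someI_ex) (use q in auto)
    have "u i < u j" "u j \<le> d i" "d i < d j"
      using i j pq unfolding crossing_def by (metis fst_conv snd_conv)+
    then have "s i \<noteq> s j" using s i j by blast
    then show ?thesis unfolding c_def i_def[symmetric] j_def[symmetric] .
  qed
  then show ?thesis unfolding proper_colouring_def by blast
qed

section \<open>From a proper colouring to a realizer of size two\<close>

definition key_order :: "'a set \<Rightarrow> ('a \<Rightarrow> 'b :: linorder) \<Rightarrow> 'a rel" where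
  "key_order X k = {(x, y). x \<in> X \<and> y \<in> X \<and> k x \<le> k y}"

lemma linear_order_key_order: "inj_on k X \<Longrightarrow> linear_order_on X (key_order X k)"
  unfolding linear_order_on_def partial_order_on_def preorder_on_def key_order_def
  by (auto simp: refl_on_def total_on_def inj_on_def intro!: transI antisymI)

text \<open>Element \<open>x\<close> is placed at the left end of its interval if \<open>c x\<close> and at the right end
  otherwise; ties are broken so that the roles of the two ends can be exchanged.\<close>

definition end_key :: "('a \<Rightarrow> nat) \<Rightarrow> ('a \<Rightarrow> nat) \<Rightarrow> ('a \<Rightarrow> int) \<Rightarrow> ('a \<Rightarrow> bool) \<Rightarrow> 'a \<Rightarrow> int \<times> int \<times> int" where
  "end_key u d t c x = (if c x then (2 * int (u x), - int (d x), t x)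
     else (2 * int (d x) + 1, - int (u x), t x))"

text \<open>First coordinates of keys lie between \<open>2 * u\<close> and \<open>2 * d + 1\<close>,
  so an interval entirely to the left of another gets the smaller key for every \<open>c\<close>.
  The third coordinate makes keys distinct.\<close>

lemma linear_extension_end_key:
  assumes "inj_on t X" "\<And>x. x \<in> X \<Longrightarrow> u x \<le> d x"
  shows "linear_extension X (interval_order X u d) (key_order X (end_key u d t c))"
  unfolding linear_extension_def
proof
  show "linear_order_on X (key_order X (end_key u d t c))"
    using assms(1) by (intro linear_order_key_order) (auto simp: inj_on_def end_key_def split: if_splits)
  show "interval_order X u d \<subseteq> key_order X (end_key u d t c)"
  proof clarify
    fix x y assume "(x, y) \<in> interval_order X u d"
    then show "(x, y) \<in> key_order X (end_key u d t c)"
      using assms(2)[of x] assms(2)[of y]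
      by (cases "x = y") (auto simp: interval_order_def key_order_def end_key_def)
  qed
qed

text \<open>The \<open>LEAST\<close> in \<open>poset_dim\<close> yields a realizer only once some
  finite realizer is known; all choices of \<open>c\<close> together form one.\<close>

lemma realizer_interval_order:
  assumes fin: "finite X" and t: "inj_on t X" and le: "\<And>x. x \<in> X \<Longrightarrow> u x \<le> d x"
  shows "realizer X (interval_order X u d) (range (\<lambda>c. key_order X (end_key u d t c)))"
proof -
  have "range (\<lambda>c. key_order X (end_key u d t c)) \<subseteq> Pow (X \<times> X)"
    by (auto simp: key_order_def)
  then have "finite (range (\<lambda>c. key_order X (end_key u d t c)))"
    using fin finite_subset by blast
  \<comment> \<open>With only y at its left end and every other point at its right end, some x
    distinct from y stays below y only if d x < u y.\<close>
  moreover have "(x, y) \<in> interval_order X u d" if "\<And>c. (x, y) \<in> key_order X (end_key u d t c)" for x y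
    using that[of "\<lambda>z. z = y"] by (auto simp: key_order_def end_key_def interval_order_def split: if_splits)
  moreover have "\<forall>L\<in>range (\<lambda>c. key_order X (end_key u d t c)). linear_extension X (interval_order X u d) L"
    using linear_extension_end_key[OF t le] by auto
  ultimately show ?thesis
    unfolding realizer_def by (auto simp: linear_extension_def)
qed

lemma realizer_of_poset_dim:
  assumes "realizer X r R" "poset_dim X r \<le> 2"
  shows "\<exists>L1 L2. linear_extension X r L1 \<and> linear_extension X r L2 \<and> L1 \<inter> L2 = r"
proof -
  have "\<exists>S. realizer X r S \<and> card S = poset_dim X r"
    unfolding poset_dim_def by (rule LeastI_ex) (use assms(1) in blast)
  then obtain S where S: "realizer X r S" "card S \<le> 2" using assms(2) by auto
  then have "card S = 1 \<or> card S = 2"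
    by (metis One_nat_def card_gt_0_iff le_Suc_eq le_zero_eq not_less_iff_gr_or_eq numeral_2_eq_2 realizer_def)
  \<comment> \<open>A realizer of size 1 is covered by taking its only member twice.\<close>
  then obtain L1 L2 where "S = {L1, L2}"
    by (metis card_1_singletonE card_2_iff insert_absorb2)
  then show ?thesis using S(1) by (auto simp: realizer_def)
qed

lemma poset_dim_le_2:
  assumes "linear_extension X r L1" "linear_extension X r L2" "L1 \<inter> L2 = r"
  shows "poset_dim X r \<le> 2"
proof -
  have "realizer X r {L1, L2}" using assms by (auto simp: realizer_def)
  then have "poset_dim X r \<le> card {L1, L2}"
    unfolding poset_dim_def by (intro Least_le) blast
  also have "\<dots> \<le> 2" by (simp add: card_insert_if)
  finally show ?thesis .
qed

lemma poset_dim_le_2_imp_proper: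
  assumes fin: "finite X" and le: "\<And>x. x \<in> X \<Longrightarrow> u x \<le> d x" and img: "u ` X = d ` X"
    and dim: "poset_dim X (interval_order X u d) \<le> 2"
  shows "\<exists>c. proper_colouring c ((\<lambda>x. (u x, d x)) ` X)"
proof -
  obtain t :: "'a \<Rightarrow> nat" where t: "inj_on t X" using finite_imp_inj_to_nat_seg[OF fin] by blast
  then have "inj_on (\<lambda>x. int (t x)) X" by (auto simp: inj_on_def)
  from realizer_of_poset_dim[OF realizer_interval_order[OF fin this le] dim]
  show ?thesis using realizer_imp_proper[OF _ _ _ le img] unfolding linear_extension_def by blast
qed

lemma proper_imp_poset_dim_le_2:
  assumes fin: "finite X" and le: "\<And>x. x \<in> X \<Longrightarrow> u x \<le> d x"
    and col: "proper_colouring c ((\<lambda>x. (u x, d x)) ` X)"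
  shows "poset_dim X (interval_order X u d) \<le> 2"
proof -
  obtain t' :: "'a \<Rightarrow> nat" where t': "inj_on t' X" using finite_imp_inj_to_nat_seg[OF fin] by blast
  define t where "t x = int (t' x)" for x
  define C where "C x = c (u x, d x)" for x
  have t: "inj_on t X" "inj_on (\<lambda>x. - t x) X" using t' by (auto simp: inj_on_def t_def)
  let ?r = "interval_order X u d"
  let ?L1 = "key_order X (end_key u d t C)"
  let ?L2 = "key_order X (end_key u d (\<lambda>x. - t x) (\<lambda>x. \<not> C x))"
  have 1: "linear_extension X ?r ?L1" "linear_extension X ?r ?L2"
    by (intro linear_extension_end_key t le; assumption)+
  have "(x, y) \<in> ?r" if xy: "(x, y) \<in> ?L1" "(x, y) \<in> ?L2" for x y
  proof (rule ccontr)
    assume no: "(x, y) \<notin> ?r"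
    have X: "x \<in> X" "y \<in> X" using xy by (auto simp: key_order_def)
    with no have ne: "x \<noteq> y" "u y \<le> d x" by (auto simp: interval_order_def)
    have "t x \<noteq> t y" using t X ne by (auto simp: inj_on_def)
    have keys: "end_key u d t C x \<le> end_key u d t C y"
      "end_key u d (\<lambda>x. - t x) (\<lambda>x. \<not> C x) x \<le> end_key u d (\<lambda>x. - t x) (\<lambda>x. \<not> C x) y"
      using xy by (auto simp: key_order_def)
    show False
    proof (cases "C x = C y")
      case False
      \<comment> \<open>One of the two orders has x at its right end and y at its left end, which
        gives 2 * d x + 1 \<le> 2 * u y.\<close>
      then show ?thesis using keys ne le[OF X(1)] le[OF X(2)]
        by (cases "C x") (auto simp: end_key_def)
    next
      case True
      \<comment> \<open>One order compares left ends and the other right ends. The negated second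
        coordinates exclude a tie in exactly one end, and the opposite signs of t exclude a tie in
        both.\<close>
      have "u x < u y \<and> d x < d y"
      proof (cases "C x")
        case True
        then show ?thesis using keys \<open>t x \<noteq> t y\<close> \<open>C x = C y\<close> by (simp add: end_key_def) linarith
      next
        case False
        then show ?thesis using keys \<open>t x \<noteq> t y\<close> \<open>C x = C y\<close> by (simp add: end_key_def) linarith
      qed
      then show ?thesis
        using col X ne True by (auto simp: proper_colouring_def C_def crossing_def)
    qed
  qed
  then have "?L1 \<inter> ?L2 = ?r" using 1 by (auto simp: linear_extension_def)
  with 1 show ?thesis by (rule poset_dim_le_2)
qed

section \<open>Words\<close>

type_synonym step = "bool \<times> bool"

definition ups :: "step list \<Rightarrow> nat \<Rightarrow> nat" where
  "ups w i = length (filter fst (take i w))"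

definition downs :: "step list \<Rightarrow> nat \<Rightarrow> nat" where
  "downs w i = length (filter snd (take i w))"

definition valid_word :: "step list \<Rightarrow> bool" where
  "valid_word w \<longleftrightarrow> (\<forall>i\<le>length w. ups w i \<le> downs w i) \<and> ups w (length w) = downs w (length w)"

definition points :: "step list \<Rightarrow> nat \<Rightarrow> (nat \<times> nat) set" where
  "points w k = (\<lambda>i. (ups w i, downs w i)) ` {..k}"

lemma ups_0 [simp]: "ups w 0 = 0" and downs_0 [simp]: "downs w 0 = 0"
  by (simp_all add: ups_def downs_def)

lemma ups_Suc: "i < length w \<Longrightarrow> ups w (Suc i) = ups w i + of_bool (fst (w ! i))"
  and downs_Suc: "i < length w \<Longrightarrow> downs w (Suc i) = downs w i + of_bool (snd (w ! i))"
  by (simp_all add: ups_def downs_def take_Suc_conv_app_nth)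

lemma length_filter_take_mono: "i \<le> j \<Longrightarrow> length (filter P (take i w)) \<le> length (filter P (take j w))"
  by (metis append_take_drop_id filter_append le_add1 length_append min.absorb1 take_take)

lemma ups_mono: "i \<le> j \<Longrightarrow> ups w i \<le> ups w j" and downs_mono: "i \<le> j \<Longrightarrow> downs w i \<le> downs w j"
  by (simp_all add: ups_def downs_def length_filter_take_mono)

text \<open>Increments of at most 1 cannot jump over a value. Together with its analogue for
  \<open>downs\<close> this makes every left end of a valid word a right end and conversely.\<close>

lemma ups_attains:
  assumes "v \<le> ups w k" "k \<le> length w" shows "\<exists>i\<le>k. ups w i = v"
  using assms
proof (induction k)
  case (Suc k)
  show ?case
  proof (cases "v \<le> ups w k")
    case True
    with Suc show ?thesis by (metis Suc_leD le_SucI)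
  next
    case False
    with Suc.prems have "ups w (Suc k) = v"
      using ups_Suc[of k w] by (cases "fst (w ! k)") auto
    then show ?thesis by blast
  qed
qed auto

lemma downs_attains:
  assumes "v \<le> downs w k" "k \<le> length w" shows "\<exists>i\<le>k. downs w i = v"
  using assms
proof (induction k)
  case (Suc k)
  show ?case
  proof (cases "v \<le> downs w k")
    case True
    with Suc show ?thesis by (metis Suc_leD le_SucI)
  next
    case False
    with Suc.prems have "downs w (Suc k) = v"
      using downs_Suc[of k w] by (cases "snd (w ! k)") auto
    then show ?thesis by blast
  qed
qed auto


section \<open>Semiorders as words\<close>

lemma finite_between:
  fixes L U :: "real set"
  assumes "finite L" "finite U" "L \<noteq> {}" "\<And>l h. l \<in> L \<Longrightarrow> h \<in> U \<Longrightarrow> l < h"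
  shows "\<exists>x. (\<forall>l\<in>L. l < x) \<and> (\<forall>h\<in>U. x < h)"
proof (cases "U = {}")
  case True
  have "l < Max L + 1" if "l \<in> L" for l using Max_ge[OF assms(1) that] by simp
  then show ?thesis using True by blast
next
  case False
  then have "Max L < Min U" using assms by simp
  then obtain x where "Max L < x" "x < Min U" using dense by blast
  then show ?thesis using assms False by (intro exI[of _ x]) auto
qed

text \<open>Points are inserted from left to right. The new left end must exceed all earlier left
  ends and the right ends of intervals entirely before it (\<open>L\<close>), and stay below the
  right ends of those it meets (\<open>U\<close>); monotonicity makes these bounds
  compatible.\<close>

lemma unit_representation:
  fixes u d :: "nat \<Rightarrow> nat"
  assumes "mono u" "mono d"
  shows "\<exists>a :: nat \<Rightarrow> real. \<forall>j\<le>n. \<forall>i<j. a i < a j \<and> (d i < u j \<longrightarrow> a i + 1 < a j) \<and>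
    (u j \<le> d i \<longrightarrow> a j < a i + 1)"
proof (induction n)
  case (Suc n)
  then obtain a :: "nat \<Rightarrow> real" where
    a: "\<And>i j. i < j \<Longrightarrow> j \<le> n \<Longrightarrow> a i < a j"
       "\<And>i j. i < j \<Longrightarrow> j \<le> n \<Longrightarrow> d i < u j \<Longrightarrow> a i + 1 < a j"
       "\<And>i j. i < j \<Longrightarrow> j \<le> n \<Longrightarrow> u j \<le> d i \<Longrightarrow> a j < a i + 1" by blast
  define L where "L = a ` {..n} \<union> (\<lambda>i. a i + 1) ` {i \<in> {..n}. d i < u (Suc n)}"
  define U where "U = (\<lambda>i. a i + 1) ` {i \<in> {..n}. u (Suc n) \<le> d i}"
  \<comment> \<open>If k lies after i, then u k \<le> u (Suc n) \<le> d i, so intervals i and k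
    already meet.\<close>
  have "a k < a i + 1" if "k \<le> n" "i \<le> n" "u (Suc n) \<le> d i" for i k
  proof (cases "k \<le> i")
    case True
    then show ?thesis using a(1)[of k i] that by (cases "k = i") auto
  next
    case False
    moreover have "u k \<le> d i" using monoD[OF assms(1), of k "Suc n"] that by simp
    ultimately show ?thesis using a(3)[of i k] that by simp
  qed
  \<comment> \<open>An interval entirely before the new one has a smaller d than one meeting it,
    hence also a smaller index.\<close>
  moreover have "a k + 1 < a i + 1" if "k \<le> n" "i \<le> n" "d k < u (Suc n)" "u (Suc n) \<le> d i" for i k
  proof -
    have "\<not> i \<le> k" using monoD[OF assms(2), of i k] that by linarith
    then show ?thesis using a(1)[of k i] that by simp
  qed
  ultimately have "l < h" if "l \<in> L" "h \<in> U" for l h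
    using that by (auto simp: L_def U_def)
  moreover have "finite L" "finite U" "L \<noteq> {}" by (auto simp: L_def U_def)
  ultimately obtain x where x: "\<forall>l\<in>L. l < x" "\<forall>h\<in>U. x < h"
    using finite_between by metis
  have "(a(Suc n := x)) i < (a(Suc n := x)) j \<and> (d i < u j \<longrightarrow> (a(Suc n := x)) i + 1 < (a(Suc n := x)) j) \<and>
    (u j \<le> d i \<longrightarrow> (a(Suc n := x)) j < (a(Suc n := x)) i + 1)" if "j \<le> Suc n" "i < j" for i j
  proof (cases "j = Suc n")
    case True
    then have "i \<le> n" "i \<noteq> Suc n" using that by auto
    then show ?thesis using x True by (auto simp: L_def U_def)
  next
    case False
    then show ?thesis using a[of i j] that by simp
  qed
  then show ?case by blast
qed simp

definition word_order :: "step list \<Rightarrow> nat rel" where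
  "word_order w = interval_order {..length w} (ups w) (downs w)"

lemma finite_poset_interval_order:
  assumes "finite X" "X \<noteq> {}" "\<And>x. x \<in> X \<Longrightarrow> u x \<le> d x"
  shows "finite_poset X (interval_order X u d)"
  using assms unfolding finite_poset_def partial_order_on_def preorder_on_def interval_order_def
  by (auto simp: refl_on_def intro!: transI antisymI dest: assms(3)) (meson assms(3) leD le_trans less_le_trans order.strict_trans)+

lemma semiorder_word_order:
  assumes "valid_word w"
  shows "semiorder {..length w} (word_order w)"
proof -
  have le: "ups w i \<le> downs w i" if "i \<in> {..length w}" for i
    using assms that by (auto simp: valid_word_def)
  obtain a :: "nat \<Rightarrow> real" where a: "\<And>i j. i < j \<Longrightarrow> j \<le> length w \<Longrightarrow> a i < a j"
       "\<And>i j. i < j \<Longrightarrow> j \<le> length w \<Longrightarrow> downs w i < ups w j \<Longrightarrow> a i + 1 < a j"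
       "\<And>i j. i < j \<Longrightarrow> j \<le> length w \<Longrightarrow> ups w j \<le> downs w i \<Longrightarrow> a j < a i + 1"
    using unit_representation[of "ups w" "downs w" "length w"]
    by (auto simp: mono_def ups_mono downs_mono)
  have "((x, y) \<in> word_order w \<and> x \<noteq> y) \<longleftrightarrow> a x + 1 < a y" if "x \<le> length w" "y \<le> length w" for x y
  proof (cases "x < y")
    case True
    then show ?thesis using a(2,3)[of x y] that
      by (cases "downs w x < ups w y") (auto simp: word_order_def interval_order_def)
  next
    case False
    then have "\<not> a x + 1 < a y" using a(1)[of y x] that by (cases "x = y") auto
    moreover have "\<not> downs w x < ups w y"
      using False ups_mono[of y x w] le[of x] that by auto
    ultimately show ?thesis by (auto simp: word_order_def interval_order_def)
  qed
  moreover have "finite_poset {..length w} (word_order w)"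
    unfolding word_order_def by (rule finite_poset_interval_order) (use le in auto)
  ultimately show ?thesis
    unfolding semiorder_def
    by (intro conjI exI[of _ a] exI[of _ "\<lambda>x. a x + 1"] exI[of _ 1]) auto
qed

section \<open>The word of a semiorder\<close>

lemma down_closed_eq_lessThan:
  assumes "finite A" "\<And>i j. j \<in> A \<Longrightarrow> i \<le> j \<Longrightarrow> i \<in> A"
  shows "A = {..<card A :: nat}"
proof (cases "A = {}")
  case False
  have "A = {..Max A}" using assms False by (auto intro: Max_in)
  then show ?thesis by (metis card_atMost lessThan_Suc_atMost)
qed simp

text \<open>Here \<open>f j\<close> plays the number of points below j, these being the first
  \<open>f j\<close> points. Replacing numbers by their rank among the positive values of
  \<open>f\<close> turns the test i < f j into a comparison of ranks, because \<open>f j\<close> is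
  itself such a value. The rank of i is \<open>downs w i\<close>, that of \<open>f j\<close> is
  \<open>ups w j\<close>.\<close>

lemma word_of_predecessor_counts:
  assumes mono: "\<And>i j. i \<le> j \<Longrightarrow> j \<le> m \<Longrightarrow> f i \<le> f j" and le: "\<And>j. j \<le> m \<Longrightarrow> f j \<le> j"
  shows "\<exists>w. length w = m \<and> valid_word w \<and> (\<forall>i\<le>m. \<forall>j\<le>m. downs w i < ups w j \<longleftrightarrow> i < f j)"
proof -
  define w where "w = map (\<lambda>k. (f k < f (Suc k), Suc k \<in> f ` {..m})) [0..<m]"
  define V where "V k = {v \<in> f ` {..m}. 0 < v \<and> v \<le> k}" for k
  have fin [simp]: "finite (V k)" for k by (auto simp: V_def)
  have len [simp]: "length w = m" by (simp add: w_def)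
  have ups: "ups w j = card (V (f j))" if "j \<le> m" for j
    using that
  proof (induction j)
    case 0
    have "V (f 0) = {}" using le[of 0] by (auto simp: V_def)
    then show ?case by simp
  next
    case (Suc j)
    show ?case
    proof (cases "f j < f (Suc j)")
      case True
      have "v = f (Suc j)" if "v \<in> V (f (Suc j))" "v \<notin> V (f j)" for v
      proof -
        have "v \<in> f ` {..m}" "f j < v" "v \<le> f (Suc j)" using that by (auto simp: V_def)
        then obtain i where i: "v = f i" "i \<le> m" "f j < f i" "f i \<le> f (Suc j)" by auto
        then have "\<not> i \<le> j" using mono[of i j] Suc.prems by auto
        then show ?thesis using i mono[of "Suc j" i] by auto
      qed
      then have "V (f (Suc j)) = insert (f (Suc j)) (V (f j))"
        using True Suc.prems by (auto simp: V_def)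
      moreover have "f (Suc j) \<notin> V (f j)" using True by (auto simp: V_def)
      ultimately show ?thesis using Suc True by (simp add: ups_Suc) (simp add: w_def)
    next
      case False
      then have "f (Suc j) = f j" using mono[of j "Suc j"] Suc.prems by simp
      then show ?thesis using Suc False by (simp add: ups_Suc) (simp add: w_def)
    qed
  qed
  have downs: "downs w i = card (V i)" if "i \<le> m" for i
    using that
  proof (induction i)
    case 0
    then show ?case by (auto simp: V_def)
  next
    case (Suc i)
    have "V (Suc i) = (if Suc i \<in> f ` {..m} then insert (Suc i) (V i) else V i)"
      by (auto simp: V_def le_Suc_eq intro: rev_image_eqI[OF _ sym])
    moreover have "Suc i \<notin> V i" by (auto simp: V_def)
    ultimately show ?case using Suc by (simp add: downs_Suc) (simp add: w_def)
  qed
  have "downs w i < ups w j \<longleftrightarrow> i < f j" if "i \<le> m" "j \<le> m" for i j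
  proof (cases "i < f j")
    case True
    then have "V i \<subseteq> V (f j)" "f j \<in> V (f j)" "f j \<notin> V i" using that by (auto simp: V_def)
    then have "V i \<subset> V (f j)" by blast
    then show ?thesis using True psubset_card_mono[of "V (f j)" "V i"] ups downs that by simp
  next
    case False
    then have "V (f j) \<subseteq> V i" using that by (auto simp: V_def)
    then show ?thesis using False card_mono[of "V i" "V (f j)"] ups downs that by simp
  qed
  moreover have "valid_word w"
    unfolding valid_word_def
  proof (intro conjI allI impI)
    show "ups w i \<le> downs w i" if "i \<le> length w" for i
      using that le[of i] ups[of i] downs[of i] by (auto simp: V_def intro!: card_mono)
    \<comment> \<open>No value of \<open>f\<close> exceeds \<open>f m\<close>, so both ends have the
      same final rank.\<close>
    have "V (f m) = V m" using mono le[of m] by (force simp: V_def)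
    then show "ups w (length w) = downs w (length w)" using ups downs by simp
  qed
  ultimately show ?thesis using len by blast
qed

lemma sorting_enumeration:
  fixes g :: "'a \<Rightarrow> real"
  assumes "finite X"
  shows "\<exists>q. bij_betw q {..<card X} X \<and> (\<forall>i j. i \<le> j \<longrightarrow> j < card X \<longrightarrow> g (q i) \<le> g (q j))"
proof -
  obtain xs where xs: "set xs = X" "distinct xs" using finite_distinct_list[OF assms] by blast
  define ys where "ys = sort_key g xs"
  have ys: "set ys = X" "distinct ys" "sorted (map g ys)" using xs by (auto simp: ys_def)
  then have len: "length ys = card X" using distinct_card by fastforce
  have "bij_betw ((!) ys) {..<card X} X"
    using bij_betw_nth[OF ys(2)] ys(1) len by simp
  moreover have "g (ys ! i) \<le> g (ys ! j)" if "i \<le> j" "j < card X" for i j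
    using sorted_nth_mono[OF ys(3) that(1)] that len by simp
  ultimately show ?thesis by blast
qed

text \<open>Equal lengths make the right ends sorted along with the left ends. So the predecessors
  of each point form an initial segment of the sorted enumeration, and their numbers determine the
  order.\<close>

lemma semiorder_imp_word:
  assumes "semiorder X r" "card X = Suc m"
  shows "\<exists>w p. valid_word w \<and> length w = m \<and> bij_betw p X {..m} \<and>
    r = interval_order X (ups w \<circ> p) (downs w \<circ> p)"
proof -
  from assms(1) obtain lo hi :: "'a \<Rightarrow> real" and len where poset: "finite_poset X r"
    and lohi: "\<And>x. x \<in> X \<Longrightarrow> lo x \<le> hi x \<and> hi x - lo x = len"
    and r: "\<And>x y. x \<in> X \<Longrightarrow> y \<in> X \<Longrightarrow> ((x, y) \<in> r \<and> x \<noteq> y) \<longleftrightarrow> hi x < lo y"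
    unfolding semiorder_def by blast
  have fin: "finite X" and refl: "\<And>x. x \<in> X \<Longrightarrow> (x, x) \<in> r" and sub: "r \<subseteq> X \<times> X"
    using poset by (auto simp: finite_poset_def partial_order_on_def preorder_on_def refl_on_def)
  obtain q where q: "bij_betw q {..m} X" and srt: "\<And>i j. i \<le> j \<Longrightarrow> j \<le> m \<Longrightarrow> lo (q i) \<le> lo (q j)"
    using sorting_enumeration[OF fin, of lo] assms(2) by (auto simp: lessThan_Suc_atMost less_Suc_eq_le)
  have qX: "q i \<in> X" if "i \<le> m" for i using q that by (auto simp: bij_betw_def)
  define A where "A j = {i \<in> {..m}. hi (q i) < lo (q j)}" for j
  have A: "A j = {..<card (A j)}" for j
  proof (rule down_closed_eq_lessThan)
    show "i \<in> A j" if "k \<in> A j" "i \<le> k" for i k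
      using that srt[of i k] lohi[OF qX, of i] lohi[OF qX, of k] by (auto simp: A_def)
  qed (auto simp: A_def)
  then have mem: "i \<in> A j \<longleftrightarrow> i < card (A j)" for i j by (metis lessThan_iff)
  have "card (A i) \<le> card (A j)" if "i \<le> j" "j \<le> m" for i j
    by (rule card_mono) (use srt[OF that] in \<open>auto simp: A_def\<close>)
  moreover have "card (A j) \<le> j" if "j \<le> m" for j
  proof -
    have "j \<notin> A j" using lohi[OF qX[OF that]] by (auto simp: A_def)
    then show ?thesis using mem[of j j] by simp
  qed
  ultimately have "\<exists>w. length w = m \<and> valid_word w \<and>
      (\<forall>i\<le>m. \<forall>j\<le>m. downs w i < ups w j \<longleftrightarrow> i < card (A j))"
    by (rule word_of_predecessor_counts)
  then obtain w where w: "length w = m" "valid_word w"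
    "\<And>i j. i \<le> m \<Longrightarrow> j \<le> m \<Longrightarrow> downs w i < ups w j \<longleftrightarrow> i < card (A j)"
    by blast
  define p where "p = inv_into {..m} q"
  have p: "bij_betw p X {..m}" unfolding p_def by (rule bij_betw_inv_into[OF q])
  have pm: "p x \<le> m" "q (p x) = x" if "x \<in> X" for x
    using bij_betw_apply[OF p that] bij_betw_inv_into_right[OF q that] by (simp_all add: p_def)
  have "(x, y) \<in> r \<longleftrightarrow> x = y \<or> downs w (p x) < ups w (p y)" if "x \<in> X" "y \<in> X" for x y
  proof -
    have "downs w (p x) < ups w (p y) \<longleftrightarrow> p x \<in> A (p y)"
      using w(3)[of "p x" "p y"] pm that by (simp add: mem)
    also have "\<dots> \<longleftrightarrow> (x, y) \<in> r \<and> x \<noteq> y"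
      using r[OF that] pm that by (auto simp: A_def)
    finally show ?thesis using refl that by auto
  qed
  then have "r = interval_order X (ups w \<circ> p) (downs w \<circ> p)"
    using sub by (auto simp: interval_order_def)
  with w p show ?thesis by blast
qed

section \<open>Recovering the word from the order\<close>

lemma word_eqI:
  assumes v: "valid_word w" "valid_word w'" and len: "length w = length w'"
    and eq: "\<And>i j. i \<le> length w \<Longrightarrow> j \<le> length w \<Longrightarrow> downs w i < ups w j \<longleftrightarrow> downs w' i < ups w' j"
  shows "w = w'"
proof (rule nth_equalityI)
  fix k assume k: "k < length w"
  have char: "(fst (w ! k) \<longleftrightarrow> (\<exists>i\<le>length w. downs w i < ups w (Suc k) \<and> \<not> downs w i < ups w k)) \<and>
      (snd (w ! k) \<longleftrightarrow> (\<exists>j\<le>length w. downs w k < ups w j \<and> \<not> downs w (Suc k) < ups w j))"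
    if w: "valid_word w" "k < length w" for w
  proof -
    have last: "ups w (length w) = downs w (length w)" using w by (simp add: valid_word_def)
    \<comment> \<open>An interval i ending exactly at the current left end detects whether the next
      step moves that left end; dually, an interval j starting at the next right end detects a move
      of the right end.\<close>
    have "ups w k \<le> downs w (length w)" using ups_mono[of k "length w" w] last w by simp
    then obtain i where i: "i \<le> length w" "downs w i = ups w k" using downs_attains by blast
    have "downs w (Suc k) \<le> ups w (length w)" using downs_mono[of "Suc k" "length w" w] last w by simp
    then obtain j where j: "j \<le> length w" "ups w j = downs w (Suc k)" using ups_attains by blast
    show ?thesis
      using i j ups_Suc[OF w(2)] downs_Suc[OF w(2)] by (cases "fst (w ! k)"; cases "snd (w ! k)") auto
  qed
  have "fst (w ! k) = fst (w' ! k)" "snd (w ! k) = snd (w' ! k)"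
    using char[OF v(1) k] char[OF v(2)] k eq len by auto
  then show "w ! k = w' ! k" by (simp add: prod_eq_iff)
qed (use len in simp)

text \<open>An isomorphism preserves numbers of strict predecessors, hence their multiset. In a word
  order these numbers increase weakly with the index, so the sorted multiset gives the number at
  each index. As predecessor sets are initial segments, all comparisons agree.\<close>

lemma isomorphic_word_orders:
  assumes v: "valid_word w" "valid_word w'" and len: "length w = m" "length w' = m"
    and iso: "poset_isomorphic {..m} (word_order w) {..m} (word_order w')"
  shows "w = w'"
proof -
  define A where "A w j = {i \<in> {..length w}. downs w i < ups w j}" for w j
  have A: "A w j = {..<card (A w j)}" for w j
    by (rule down_closed_eq_lessThan) (auto simp: A_def intro: le_less_trans[OF downs_mono])
  have mono: "card (A w i) \<le> card (A w j)" if "i \<le> j" for w i j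
    by (rule card_mono) (use ups_mono[OF that, of w] in \<open>auto simp: A_def\<close>)
  obtain g where g: "bij_betw g {..m} {..m}"
    and gr: "\<And>x y. x \<le> m \<Longrightarrow> y \<le> m \<Longrightarrow> (x, y) \<in> word_order w \<longleftrightarrow> (g x, g y) \<in> word_order w'"
    using iso by (auto simp: poset_isomorphic_def)
  have irrefl: "\<not> downs w j < ups w j" if "valid_word w" "j \<le> length w" for w j
    using that by (auto simp: valid_word_def not_less)
  have gm: "g x \<le> m" if "x \<le> m" for x using g that by (auto simp: bij_betw_def)
  have ginj: "g x = g y \<longleftrightarrow> x = y" if "x \<le> m" "y \<le> m" for x y
    using g that by (auto simp: bij_betw_def inj_on_def)
  have strict: "downs w x < ups w y \<longleftrightarrow> downs w' (g x) < ups w' (g y)" if "x \<le> m" "y \<le> m" for x y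
    using gr[OF that] ginj[OF that] gm that irrefl v len
    by (cases "x = y") (auto simp: word_order_def interval_order_def)
  have cnt: "card (A w j) = card (A w' (g j))" if "j \<le> m" for j
  proof (rule bij_betw_same_card)
    have "g ` A w j = A w' (g j)"
    proof (intro equalityI subsetI)
      fix y assume "y \<in> A w' (g j)"
      then have y: "y \<le> m" "downs w' y < ups w' (g j)" by (auto simp: A_def len)
      then obtain x where "x \<le> m" "y = g x" using g by (auto simp: bij_betw_def image_iff)
      then show "y \<in> g ` A w j" using y strict that by (auto simp: A_def len)
    qed (use strict gm that in \<open>auto simp: A_def len\<close>)
    then show "bij_betw g (A w j) (A w' (g j))"
      using g by (auto simp: bij_betw_def inj_on_def A_def len)
  qed
  let ?l = "\<lambda>w. map (\<lambda>j. card (A w j)) [0..<Suc m]"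
  have mset: "mset (map f [0..<Suc m]) = image_mset f (mset_set {..m})" for f :: "nat \<Rightarrow> nat"
    by (simp only: mset_map mset_upt atLeast0LessThan lessThan_Suc_atMost)
  have "mset (?l w) = image_mset (\<lambda>j. card (A w' (g j))) (mset_set {..m})"
    unfolding mset by (rule image_mset_cong) (simp add: cnt)
  also have "\<dots> = image_mset (\<lambda>j. card (A w' j)) (image_mset g (mset_set {..m}))"
    by (simp add: image_mset.compositionality comp_def)
  also have "image_mset g (mset_set {..m}) = mset_set {..m}"
    using g by (simp add: image_mset_mset_set bij_betw_def)
  also have "image_mset (\<lambda>j. card (A w' j)) (mset_set {..m}) = mset (?l w')"
    by (rule mset[symmetric])
  finally have "mset (?l w) = mset (?l w')" .
  moreover have "sorted (?l w)" for w
    by (auto simp: sorted_iff_nth_mono mono simp del: upt_Suc)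
  ultimately have "?l w = ?l w'" using properties_for_sort by metis
  then have "card (A w j) = card (A w' j)" if "j \<le> m" for j
    using that by (metis (no_types, lifting) map_eq_conv atLeastLessThan_iff less_Suc_eq_le set_upt zero_le)
  then have "A w j = A w' j" if "j \<le> m" for j using A that by metis
  then show ?thesis
    by (intro word_eqI v) (auto simp: A_def len set_eq_iff)
qed

section \<open>The automaton\<close>

text \<open>The steps \<open>(False, True)\<close>, \<open>(True, False)\<close>, \<open>(True, True)\<close> raise, lower and keep the
  height \<open>d - u\<close>; a step \<open>(False, False)\<close> repeats the interval. \<open>Fresh\<close>, \<open>Joined\<close> and \<open>Closed\<close> have
  height 0, \<open>First\<close> and \<open>Next\<close> height 1, \<open>Rise b k\<close> height \<open>k + 2\<close> and \<open>Fall b k\<close> height \<open>k + 1\<close>.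
  In \<open>Joined\<close> and \<open>Closed\<close> some intervals that start further left end at the current position \<open>u\<close>,
  in \<open>Closed\<close> with both colours, so that no longer interval can start at \<open>u\<close>. In \<open>Next\<close> and
  \<open>Rise False\<close> there are also intervals from further left that end at \<open>u\<close>, in \<open>First\<close> and
  \<open>Rise True\<close> there are none. In \<open>Fall False\<close> both colours occur among the intervals that
  end at \<open>d\<close>.\<close>

datatype state = Fresh | Joined | Closed | First | Next | Rise bool nat | Fall bool nat | Dead

text \<open>The catch-all sends a step to \<open>Dead\<close> if it would make the height negative
  or if no valid completion of the word could be properly coloured.\<close>

fun next_state :: "state \<Rightarrow> step \<Rightarrow> state" where
  "next_state q (False, False) = q"
| "next_state Fresh (False, True) = First"
| "next_state Fresh (True, True) = Fresh"
| "next_state Joined (False, True) = Next"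
| "next_state Joined (True, True) = Fresh"
| "next_state Closed (True, True) = Fresh"
| "next_state First (False, True) = Rise True 0"
| "next_state First (True, True) = Next"
| "next_state First (True, False) = Joined"
| "next_state Next (False, True) = Rise False 0"
| "next_state Next (True, True) = Next"
| "next_state Next (True, False) = Joined"
| "next_state (Rise b k) (False, True) = Rise b (Suc k)"
| "next_state (Rise b k) (True, True) = Fall True (Suc k)"
| "next_state (Rise b k) (True, False) = Fall b k"
| "next_state (Fall b (Suc k)) (True, False) = Fall b k"
| "next_state (Fall True 0) (True, True) = Next"
| "next_state (Fall True 0) (True, False) = Joined"
| "next_state (Fall False 0) (True, False) = Closed"
| "next_state _ _ = Dead"

fun final :: "state \<Rightarrow> bool" where
  "final Fresh = True"
| "final Joined = True"
| "final Closed = True"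
| "final _ = False"

lemma step_cases:
  obtains "st = (False, False)" | "st = (False, True)" | "st = (True, True)" | "st = (True, False)"
  by (cases st) auto


section \<open>Accepted words are those with bipartite crossing graph\<close>

text \<open>Facts about the word read so far that hold for every proper colouring \<open>c\<close> of the set \<open>S\<close>
  of all intervals of the word. They exclude the steps into \<open>Dead\<close>.\<close>

fun forced :: "state \<Rightarrow> (nat \<times> nat \<Rightarrow> bool) \<Rightarrow> (nat \<times> nat) set \<Rightarrow> nat \<Rightarrow> nat \<Rightarrow> bool" where
  "forced Fresh c S u d \<longleftrightarrow> u = d"
| "forced Joined c S u d \<longleftrightarrow> u = d \<and> (\<exists>a<u. (a, u) \<in> S)"
| "forced Closed c S u d \<longleftrightarrow> u = d \<and> (\<exists>a<u. \<exists>a'<u. (a, u) \<in> S \<and> (a', u) \<in> S \<and> c (a, u) \<noteq> c (a', u))"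
| "forced First c S u d \<longleftrightarrow> d = Suc u"
| "forced Next c S u d \<longleftrightarrow> d = Suc u \<and> (\<exists>a<u. (a, u) \<in> S)"
| "forced (Rise b k) c S u d \<longleftrightarrow> d = u + k + 2 \<and> (\<forall>y. u < y \<and> y \<le> d \<longrightarrow> (u, y) \<in> S) \<and>
     (b \<or> (\<exists>a<u. (a, u) \<in> S))"
| "forced (Fall True 0) c S u d \<longleftrightarrow> d = Suc u \<and> (\<exists>a<u. (a, u) \<in> S) \<and> (\<exists>a<u. (a, Suc u) \<in> S)"
| "forced (Fall True (Suc k)) c S u d \<longleftrightarrow> d = u + k + 2 \<and>
     (\<exists>a<u. \<forall>y. u \<le> y \<and> y < d \<longrightarrow> (a, y) \<in> S)"
| "forced (Fall False k) c S u d \<longleftrightarrow> d = u + k + 1 \<and>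
     (\<exists>a<u. (\<forall>y. u \<le> y \<and> y \<le> d \<longrightarrow> (a, y) \<in> S \<and> c (a, y) = c (a, d)) \<and> c (a, d) \<noteq> c (u, d))"
| "forced Dead c S u d \<longleftrightarrow> False"

lemma proper_colouringD: "proper_colouring c S \<Longrightarrow> (a, b) \<in> S \<Longrightarrow> (a', b') \<in> S \<Longrightarrow> a < a' \<Longrightarrow> a' \<le> b \<Longrightarrow> b < b' \<Longrightarrow> c (a, b) \<noteq> c (a', b')"
  unfolding proper_colouring_def crossing_def by fastforce

text \<open>The hypothesis \<open>col\<close> looks ahead to an interval starting at
  \<open>Suc u\<close> that reaches at least the next right end. It closes the odd cycles that
  exclude rising steps during a fall.\<close>

lemma forced_next_state:
  assumes P: "proper_colouring c S" and cur: "(u, d) \<in> S"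
    and nxt: "(u + of_bool (fst st), d + of_bool (snd st)) \<in> S"
    and le: "u + of_bool (fst st) \<le> d + of_bool (snd st)"
    and col: "u < d \<Longrightarrow> \<exists>y. y \<ge> d + of_bool (snd st) \<and> (Suc u, y) \<in> S"
    and forced: "forced q c S u d"
  shows "forced (next_state q st) c S (u + of_bool (fst st)) (d + of_bool (snd st))"
proof -
  note D = proper_colouringD[OF P]
  \<comment> \<open>The intervals (a, u), (u, d), (Suc u, y), (a', Suc u), (u, Suc d) form a 5-cycle
    of crossings.\<close>
  have no_N: False if "d = Suc u" "st = (False, True)" "a < u" "(a, u) \<in> S" "a' < u" "(a', Suc u) \<in> S" for a a'
  proof -
    from that col obtain y where y: "y \<ge> Suc d" "(Suc u, y) \<in> S" by auto
    have x: "(u, Suc d) \<in> S" using nxt that by simp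
    have "c (a, u) \<noteq> c (u, d)" "c (a, u) \<noteq> c (u, Suc d)" "c (a', Suc u) \<noteq> c (u, Suc d)"
      "c (a', Suc u) \<noteq> c (Suc u, y)" "c (u, d) \<noteq> c (Suc u, y)"
      using D[OF that(4) cur] D[OF that(4) x] D[OF that(6) x] D[OF that(6) y(2)] D[OF cur y(2)] that y
      by auto
    then show False by blast
  qed
  \<comment> \<open>The intervals (a, Suc u), (u, d), (Suc u, y) cross pairwise.\<close>
  have no_ND: False if "d = u + k + 2" "snd st" "a < u" "\<And>y. u \<le> y \<Longrightarrow> y < d \<Longrightarrow> (a, y) \<in> S" for a k
  proof -
    have "u < d" using that by simp
    from col[OF this] that obtain y where y: "y \<ge> Suc d" "(Suc u, y) \<in> S" by auto
    have x: "(a, Suc u) \<in> S" using that by simp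
    show False
      using D[OF x cur] D[OF x y(2)] D[OF cur y(2)] that y by auto
  qed
  show ?thesis
  proof (cases st rule: step_cases)
    case 1
    then show ?thesis using forced by simp
  next
    case 2
    note st = this
    show ?thesis
    proof (cases q)
      case Closed
      then obtain a a' where a: "u = d" "a < u" "a' < u" "(a, u) \<in> S" "(a', u) \<in> S" "c (a, u) \<noteq> c (a', u)"
        using forced by auto
      have x: "(u, Suc u) \<in> S" using nxt st a by simp
      have False using D[OF a(4) x] D[OF a(5) x] a by auto
      then show ?thesis ..
    next
      case (Rise b k)
      then show ?thesis using forced nxt st by (auto simp: le_Suc_eq)
    next
      case (Fall b k)
      show ?thesis
      proof (cases b)
        case True
        then show ?thesis using forced Fall st no_N no_ND by (cases k) auto
      next
        case False
        with Fall forced obtain a where a: "d = u + k + 1" "a < u"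
          "\<And>y. u \<le> y \<Longrightarrow> y \<le> d \<Longrightarrow> (a, y) \<in> S" by auto
        then show ?thesis
          using no_N[of a a] no_ND[of "k - 1" a] st by (cases k) auto
      qed
    qed (use forced st cur nxt in \<open>auto simp: le_Suc_eq\<close>)
  next
    case 3
    note st = this
    show ?thesis
    proof (cases q)
      case (Rise b k)
      then show ?thesis using forced nxt st by (auto intro!: exI[of _ u])
    next
      case (Fall b k)
      show ?thesis
      proof (cases b)
        case True
        then show ?thesis using forced Fall st no_ND cur by (cases k) auto
      next
        case False
        with Fall forced obtain a where a: "d = u + k + 1" "a < u" "c (a, d) \<noteq> c (u, d)"
          "\<And>y. u \<le> y \<Longrightarrow> y \<le> d \<Longrightarrow> (a, y) \<in> S" by auto
        \<comment> \<open>The new interval would cross both (a, d) and (u, d), which have different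
          colours.\<close>
        have "k = 0 \<Longrightarrow> False"
          using a D[OF a(4) nxt] D[OF cur nxt] st by auto
        then show ?thesis
          using no_ND[of "k - 1" a] a st by (cases k) auto
      qed
    qed (use forced st cur in auto)
  next
    case 4
    note st = this
    show ?thesis
    proof (cases q)
      case (Rise b k)
      have *: "\<And>y. u < y \<Longrightarrow> y \<le> d \<Longrightarrow> (u, y) \<in> S" "d = u + k + 2" using forced Rise by auto
      show ?thesis
      proof (cases b)
        case True
        then show ?thesis using * Rise st nxt by (cases k) (auto intro!: exI[of _ u])
      next
        case False
        with forced Rise obtain a where a: "a < u" "(a, u) \<in> S" by auto
        have col: "c (u, y) = (\<not> c (a, u))" if "u < y" "y \<le> d" for y
          \<comment> \<open>All intervals of the rise cross (a, u) and hence share a colour. Since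
            (u, d - 1) crosses the new interval (Suc u, d), the latter differs in colour from (u,
            d), as \<open>Fall False\<close> records.\<close>
          using D[OF a(2) *(1)[OF that]] a that by auto
        have "c (u, d - 1) \<noteq> c (Suc u, d)"
          using D[OF *(1)[of "d - 1"] nxt] * st by auto
        then have "c (u, d) \<noteq> c (Suc u, d)" "\<And>y. u < y \<Longrightarrow> y \<le> d \<Longrightarrow> c (u, y) = c (u, d)"
          using *(2) by (simp_all add: col)
        then have "(\<forall>y. Suc u \<le> y \<and> y \<le> d \<longrightarrow> (u, y) \<in> S \<and> c (u, y) = c (u, d)) \<and> c (u, d) \<noteq> c (Suc u, d)"
          using *(1) Suc_le_lessD by blast
        moreover have "d = Suc u + k + 1" "u < Suc u" using *(2) by simp_all
        ultimately have "forced (Fall False k) c S (Suc u) d"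
          unfolding forced.simps by blast
        then show ?thesis using Rise st False by (simp del: forced.simps)
      qed
    next
      case (Fall b k)
      show ?thesis
      proof (cases b)
        case True
        show ?thesis
        proof (cases k)
          case 0
          then show ?thesis using forced Fall True st cur by auto
        next
          case (Suc j)
          with forced Fall True obtain a where a: "d = u + j + 2" "a < u"
            "\<And>y. u \<le> y \<Longrightarrow> y < d \<Longrightarrow> (a, y) \<in> S" by auto
          show ?thesis
          proof (cases j)
            case 0
            then have "(a, Suc u) \<in> S" "a < Suc u" "(u, Suc (Suc u)) \<in> S" "u < Suc u"
              using a cur by auto
            then show ?thesis using a(1) Fall True Suc st 0 by auto
          next
            case (Suc i)
            then show ?thesis using a Fall True \<open>k = Suc j\<close> st by (auto intro!: exI[of _ a])
          qed
        qed
      next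
        case False
        then have "forced (Fall False k) c S u d" using forced Fall by (simp only: simp_thms)
        then obtain a where a: "d = u + k + 1" "a < u" "c (a, d) \<noteq> c (u, d)"
          "\<And>y. u \<le> y \<Longrightarrow> y \<le> d \<Longrightarrow> (a, y) \<in> S" "\<And>y. u \<le> y \<Longrightarrow> y \<le> d \<Longrightarrow> c (a, y) = c (a, d)"
          unfolding forced.simps by blast
        show ?thesis
        proof (cases k)
          case 0
          have "(a, Suc u) \<in> S" "(u, Suc u) \<in> S" using a(1,4) cur 0 by auto
          then have "forced Closed c S (Suc u) d" unfolding forced.simps using a(1-3) 0
            by (intro conjI exI[of _ a] exI[of _ u]) simp_all
          then show ?thesis using 0 Fall False st by (simp del: forced.simps)
        next
          case (Suc j)
          have "c (a, d - 1) \<noteq> c (Suc u, d)"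
            using D[OF a(4)[of "d - 1"] nxt] a(1,2) Suc st by auto
          then have "c (a, d) \<noteq> c (Suc u, d)" using a(5)[of "d - 1"] a(1) Suc by simp
          moreover have "\<forall>y. Suc u \<le> y \<and> y \<le> d \<longrightarrow> (a, y) \<in> S \<and> c (a, y) = c (a, d)"
            using a(4,5) Suc_leD by blast
          moreover have "d = Suc u + j + 1" "a < Suc u" using a(1,2) Suc by simp_all
          ultimately have "forced (Fall False j) c S (Suc u) d"
            unfolding forced.simps by blast
          then show ?thesis using Fall False Suc st by (simp del: forced.simps)
        qed
      qed
    qed (use forced st cur le in auto)
  qed
qed

lemma forced_final: "forced q c S u u \<Longrightarrow> final q"
  by (induction q c S u u rule: forced.induct) auto

lemma final_if_proper:
  assumes v: "valid_word w" and P: "proper_colouring c (points w (length w))"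
  shows "final (foldl next_state Fresh w)"
proof -
  let ?S = "points w (length w)"
  have "forced (foldl next_state Fresh (take i w)) c ?S (ups w i) (downs w i)" if "i \<le> length w" for i
    using that
  proof (induction i)
    case (Suc i)
    then have i: "i < length w" by simp
    have S: "(ups w j, downs w j) \<in> ?S" if "j \<le> length w" for j
      using that by (auto simp: points_def)
    \<comment> \<open>The word ends at height 0, so at positive height the left end must still pass
      through \<open>Suc (ups w i)\<close>, and it does so later.\<close>
    have "\<exists>y\<ge>downs w (Suc i). (Suc (ups w i), y) \<in> ?S" if "ups w i < downs w i"
    proof -
      have "downs w i \<le> downs w (length w)" using downs_mono i by simp
      then have "Suc (ups w i) \<le> ups w (length w)" using v that by (auto simp: valid_word_def)
      then obtain j where j: "j \<le> length w" "ups w j = Suc (ups w i)"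
        using ups_attains by blast
      then have "\<not> j \<le> i" using ups_mono[of j i w] by auto
      then show ?thesis using S[OF j(1)] j downs_mono[of "Suc i" j w] by auto
    qed
    note col = this
    have "ups w (Suc i) \<le> downs w (Suc i)" using v Suc.prems by (auto simp: valid_word_def)
    then have "forced (next_state (foldl next_state Fresh (take i w)) (w ! i)) c ?S
        (ups w (Suc i)) (downs w (Suc i))"
      using forced_next_state[OF P S[of i], of "w ! i"] S[OF Suc.prems] Suc.IH i col
      unfolding ups_Suc[OF i] downs_Suc[OF i] by simp
    then show ?case using i by (simp add: take_Suc_conv_app_nth)
  qed simp
  from this[of "length w"] v show ?thesis
    by (intro forced_final) (auto simp: valid_word_def)
qed

section \<open>Acceptance implies proper colourability\<close>

text \<open>Unlike \<open>forced\<close>, this only has to hold for one proper colouring \<open>c\<close> of the set \<open>S\<close> of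
  intervals read so far.\<close>

fun frontier :: "state \<Rightarrow> (nat \<times> nat \<Rightarrow> bool) \<Rightarrow> (nat \<times> nat) set \<Rightarrow> nat \<Rightarrow> nat \<Rightarrow> bool" where
  "frontier Fresh c S u d \<longleftrightarrow> u = d \<and> (\<forall>(a, b)\<in>S. b = u \<longrightarrow> a = u)"
| "frontier Joined c S u d \<longleftrightarrow> u = d \<and> (\<exists>x. \<forall>(a, b)\<in>S. b = u \<and> a < u \<longrightarrow> c (a, b) = x)"
| "frontier Closed c S u d \<longleftrightarrow> u = d"
| "frontier First c S u d \<longleftrightarrow> d = Suc u \<and> (\<forall>(a, b)\<in>S. a < u \<longrightarrow> b < u)"
| "frontier Next c S u d \<longleftrightarrow> d = Suc u \<and>
     (\<exists>x. \<forall>(a, b)\<in>S. (b = u \<and> a < u \<longrightarrow> c (a, b) = x) \<and> (b = Suc u \<longrightarrow> a = u \<and> c (a, b) = (\<not> x)))"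
| "frontier (Rise True k) c S u d \<longleftrightarrow> d = u + k + 2 \<and>
     (\<exists>x. \<forall>(a, b)\<in>S. (a < u \<longrightarrow> b < u) \<and> (a = u \<and> u < b \<longrightarrow> c (a, b) = x))"
| "frontier (Rise False k) c S u d \<longleftrightarrow> d = u + k + 2 \<and>
     (\<exists>x. \<forall>(a, b)\<in>S. (a < u \<longrightarrow> b \<le> u) \<and> (a < u \<and> b = u \<longrightarrow> c (a, b) = x) \<and>
        (a = u \<and> u < b \<longrightarrow> c (a, b) = (\<not> x)))"
| "frontier (Fall True k) c S u d \<longleftrightarrow> d = u + k + 1 \<and>
     (\<exists>x. \<forall>(a, b)\<in>S. (u \<le> b \<and> b < d \<longrightarrow> c (a, b) = x) \<and> (b = d \<longrightarrow> c (a, b) = (\<not> x)))"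
| "frontier (Fall False k) c S u d \<longleftrightarrow> d = u + k + 1 \<and>
     (\<exists>x. \<forall>(a, b)\<in>S. u \<le> b \<and> b < d \<longrightarrow> c (a, b) = x)"
| "frontier Dead c S u d \<longleftrightarrow> False"

text \<open>Both ends of the new interval are maximal, so it can only be the right-hand member of a
  crossing, and the earlier intervals crossing it all have the opposite colour.\<close>

lemma proper_colouring_insert:
  assumes "proper_colouring c S" "\<And>a b. (a, b) \<in> S \<Longrightarrow> a \<le> u \<and> b \<le> d"
    "(u, d) \<notin> S"
    "\<And>a b. (a, b) \<in> S \<Longrightarrow> a < u \<Longrightarrow> u \<le> b \<Longrightarrow> b < d \<Longrightarrow> c (a, b) = (\<not> x)"
  shows "proper_colouring (c((u, d) := x)) (insert (u, d) S)"
proof -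
  have "(c((u, d) := x)) p \<noteq> (c((u, d) := x)) q"
    if p: "p \<in> insert (u, d) S" and q: "q \<in> insert (u, d) S" and pq: "crossing p q" for p q
  proof -
    obtain a b a' b' where [simp]: "p = (a, b)" "q = (a', b')" by (cases p, cases q) auto
    have cr: "a < a'" "a' \<le> b" "b < b'" using pq by (auto simp: crossing_def)
    have pS: "(a, b) \<in> S"
      using p q assms(2)[of a' b'] cr by auto
    show ?thesis
    proof (cases "(a', b') = (u, d)")
      case True
      then show ?thesis using assms(4)[OF pS] cr pS assms(3) by auto
    next
      case False
      then show ?thesis using assms(1,3) q pS pq by (auto simp: proper_colouring_def)
    qed
  qed
  then show ?thesis by (auto simp: proper_colouring_def)
qed

text \<open>Greedy colouring: in every live transition the invariant makes the earlier intervals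
  that cross the new one monochromatic. Only the fall out of \<open>Rise True\<close> also changes
  an old colour.\<close>

lemma frontier_next_state:
  assumes P: "proper_colouring c S" and below: "\<And>a b. (a, b) \<in> S \<Longrightarrow> a \<le> u \<and> b \<le> d \<and> a \<le> b"
    and cur: "(u, d) \<in> S" and frontier: "frontier q c S u d" and alive: "next_state q st \<noteq> Dead"
  defines "u' \<equiv> u + of_bool (fst st)" and "d' \<equiv> d + of_bool (snd st)"
  shows "\<exists>c'. proper_colouring c' (insert (u', d') S) \<and> frontier (next_state q st) c' (insert (u', d') S) u' d'"
proof (cases "st = (False, False)")
  case True
  then have "insert (u', d') S = S" "u' = u" "d' = d" using cur by (auto simp: u'_def d'_def)
  then show ?thesis using P frontier True by auto
next
  case False
  have new: "(u', d') \<notin> S" using below[of u' d'] False by (cases st) (auto simp: u'_def d'_def)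
  have top: "(a, Suc d) \<notin> S" for a using below[of a "Suc d"] by auto
  have le: "\<And>a b. (a, b) \<in> S \<Longrightarrow> a \<le> u' \<and> b \<le> d'" using below by (fastforce simp: u'_def d'_def)
  have ext: ?thesis
    if "\<And>a b. (a, b) \<in> S \<Longrightarrow> a < u' \<Longrightarrow> u' \<le> b \<Longrightarrow> b < d' \<Longrightarrow> c (a, b) = (\<not> x)"
      "frontier (next_state q st) (c((u', d') := x)) (insert (u', d') S) u' d'" for x
    using proper_colouring_insert[OF P le new] that by blast
  from False consider "st = (False, True)" | "st = (True, True)" | "st = (True, False)"
    by (cases st) auto
  then show ?thesis
  proof cases
    case 1
    then have [simp]: "u' = u" "d' = Suc d" by (auto simp: u'_def d'_def)
    show ?thesis
    proof (cases q)
      case Fresh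
      then have "u = d" and eq: "\<And>a b. (a, b) \<in> S \<Longrightarrow> b = u \<Longrightarrow> a = u" using frontier by auto
      moreover have "b < u" if "(a, b) \<in> S" "a < u" for a b
        using below[OF that(1)] eq[OF that(1)] that \<open>u = d\<close> by (cases "b = u") auto
      ultimately have *: "u = d" "\<And>a b. (a, b) \<in> S \<Longrightarrow> a < u \<Longrightarrow> b < u" by blast+
      show ?thesis
        by (rule ext[of True]) (use Fresh 1 *(1) in \<open>auto dest: *(2)\<close>)
    next
      case Joined
      then obtain x where *: "d = u" "\<forall>(a, b)\<in>S. b = u \<and> a < u \<longrightarrow> c (a, b) = x"
        using frontier by auto
      show ?thesis
      proof (rule ext[of "\<not> x"])
        show "c (a, b) = (\<not> \<not> x)" if "(a, b) \<in> S" "a < u'" "u' \<le> b" "b < d'" for a b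
          using that * by (cases "b = u") (simp, blast, simp)
        have "\<forall>(a, b)\<in>S. (b = u \<and> a < u \<longrightarrow> c (a, b) = x) \<and> b \<noteq> Suc u"
          using * top by auto
        then show "frontier (next_state q st) (c((u', d') := \<not> x)) (insert (u', d') S) u' d'"
          using Joined 1 *(1) by (auto intro!: exI[of _ x])
      qed
    next
      case First
      then have *: "d = Suc u" "\<And>a b. (a, b) \<in> S \<Longrightarrow> a < u \<Longrightarrow> b < u" using frontier by auto
      \<comment> \<open>Nothing crosses the new interval; it copies the colour of (u, d) so that the
        rise stays monochromatic.\<close>
      obtain x where x0: "c (u, d) = x" by blast
      have "c (u, b) = x" if "(u, b) \<in> S" "u < b" for b
      proof -
        have "b = d" using below[OF that(1)] that(2) *(1) by auto
        then show ?thesis using x0 by simp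
      qed
      then have x: "\<forall>(a, b)\<in>S. (a < u \<longrightarrow> b < u) \<and> (a = u \<and> u < b \<longrightarrow> c (a, b) = x)"
        using *(2) by auto
      show ?thesis
      proof (rule ext[of x])
        show "c (a, b) = (\<not> x)" if "(a, b) \<in> S" "a < u'" "u' \<le> b" "b < d'" for a b
          using *(2)[OF that(1)] that by simp
        show "frontier (next_state q st) (c((u', d') := x)) (insert (u', d') S) u' d'"
          using First 1 *(1) x by (auto intro!: exI[of _ x])
      qed
    next
      case Next
      obtain x where d: "d = Suc u" and x: "\<forall>(a, b)\<in>S. (b = u \<and> a < u \<longrightarrow> c (a, b) = x) \<and>
          (b = Suc u \<longrightarrow> a = u \<and> c (a, b) = (\<not> x))"
        using frontier unfolding Next frontier.simps by (elim conjE exE) (rule that)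
      have "b \<le> u \<and> (b = u \<longrightarrow> c (a, b) = x)" if "(a, b) \<in> S" "a < u" for a b
        using below[OF that(1)] bspec[OF x that(1)] that(2) d by (cases "b = Suc u") auto
      moreover have "c (a, b) = (\<not> x)" if "(a, b) \<in> S" "a = u" "u < b" for a b
        using below[OF that(1)] bspec[OF x that(1)] that(2,3) d by (cases "b = Suc u") auto
      ultimately show ?thesis
        by (intro ext[of "\<not> x"]) (use Next 1 d top in \<open>auto intro!: exI[of _ x] dest: le_antisym\<close>)
    next
      case (Rise b k)
      show ?thesis
      proof (cases b)
        case True
        then have b: "b = True" by simp
        obtain x where d: "d = u + k + 2" and x: "\<forall>(a, b)\<in>S. (a < u \<longrightarrow> b < u) \<and> (a = u \<and> u < b \<longrightarrow> c (a, b) = x)"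
          using frontier unfolding Rise b frontier.simps by (elim conjE exE) (rule that)
        have "c (a, b) = x" if "(a, b) \<in> S" "a = u" "u < b" for a b
          using bspec[OF x that(1)] that(2,3) by auto
        moreover have lt: "b < u" if "(a, b) \<in> S" "a < u" for a b
          using bspec[OF x that(1)] that(2) by auto
        ultimately show ?thesis
          by (intro ext[of x]) (use Rise True 1 d in \<open>auto intro!: exI[of _ x] dest: lt\<close>)
      next
        case False
        then have b: "b = False" by simp
        obtain x where d: "d = u + k + 2" and x: "\<forall>(a, b)\<in>S. (a < u \<longrightarrow> b \<le> u) \<and>
            (a < u \<and> b = u \<longrightarrow> c (a, b) = x) \<and> (a = u \<and> u < b \<longrightarrow> c (a, b) = (\<not> x))"
          using frontier unfolding Rise b frontier.simps by (elim conjE exE) (rule that)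
        have "b \<le> u \<and> (b = u \<longrightarrow> c (a, b) = x)" if "(a, b) \<in> S" "a < u" for a b
          using bspec[OF x that(1)] that(2) by auto
        moreover have "c (a, b) = (\<not> x)" if "(a, b) \<in> S" "a = u" "u < b" for a b
          using bspec[OF x that(1)] that(2,3) by auto
        ultimately show ?thesis
          by (intro ext[of "\<not> x"]) (use Rise False 1 d top in \<open>auto intro!: exI[of _ x] dest: le_antisym\<close>)
      qed
    next
      case (Fall b k)
      then show ?thesis using 1 alive by (cases b; cases k) auto
    qed (use 1 alive in auto)
  next
    case 2
    then have [simp]: "u' = Suc u" "d' = Suc d" by (auto simp: u'_def d'_def)
    have level: ?thesis if "next_state q st = Fresh" "u = d"
      by (rule ext[of True]) (use that top in \<open>auto dest: below\<close>)
    \<comment> \<open>At height 1 the intervals crossing the new one are exactly those ending at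
      d.\<close>
    have to_Next: ?thesis if "next_state q st = Next" "d = Suc u" "\<And>a b. (a, b) \<in> S \<Longrightarrow> b = d \<Longrightarrow> c (a, b) = x" for x
      by (rule ext[of "\<not> x"]) (use that(1,2) top in \<open>auto simp: that(3) intro!: exI[of _ x]\<close>)
    show ?thesis
    proof (cases q)
      case First
      then have *: "d = Suc u" "\<And>a b. (a, b) \<in> S \<Longrightarrow> a < u \<Longrightarrow> b < u" using frontier by auto
      have "c (a, b) = c (u, d)" if "(a, b) \<in> S" "b = d" for a b
        using below[OF that(1)] *(2)[OF that(1)] that * by (cases "a = u") auto
      then show ?thesis using to_Next First 2 * by auto
    next
      case Next
      obtain x where d: "d = Suc u" and x: "\<forall>(a, b)\<in>S. (b = u \<and> a < u \<longrightarrow> c (a, b) = x) \<and>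
          (b = Suc u \<longrightarrow> a = u \<and> c (a, b) = (\<not> x))"
        using frontier unfolding Next frontier.simps by (elim conjE exE) (rule that)
      have "c (a, b) = (\<not> x)" if "(a, b) \<in> S" "b = d" for a b
        using bspec[OF x that(1)] that(2) d by auto
      then show ?thesis using to_Next[of "\<not> x"] Next 2 d by auto
    next
      case (Fall b k)
      then have b: "b = True" "k = 0" using 2 alive by (cases b; cases k; auto)+
      obtain x where d: "d = u + 0 + 1" and x: "\<forall>(a, b)\<in>S. (u \<le> b \<and> b < d \<longrightarrow> c (a, b) = x) \<and> (b = d \<longrightarrow> c (a, b) = (\<not> x))"
          using frontier unfolding Fall b frontier.simps by (elim conjE exE) (rule that)
      have "c (a, b) = (\<not> x)" if "(a, b) \<in> S" "b = d" for a b
        using bspec[OF x that(1)] that(2) by auto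
      then show ?thesis using to_Next[of "\<not> x"] Fall b d 2 by auto
    next
      case (Rise b k)
      obtain x where d: "d = u + k + 2" and x: "\<And>a b. (a, b) \<in> S \<Longrightarrow> Suc u \<le> b \<Longrightarrow> c (a, b) = x"
      proof (cases b)
        case True
        then have b: "b = True" by simp
        obtain x where d: "d = u + k + 2" and x: "\<forall>(a, b)\<in>S. (a < u \<longrightarrow> b < u) \<and> (a = u \<and> u < b \<longrightarrow> c (a, b) = x)"
          using frontier unfolding Rise b frontier.simps by (elim conjE exE) (rule that)
        have "c (a, b) = x" if "(a, b) \<in> S" "Suc u \<le> b" for a b
          using below[OF that(1)] bspec[OF x that(1)] that(2) by (cases "a = u") auto
        with d show ?thesis by (rule that)
      next
        case False
        then have b: "b = False" by simp
        obtain x where d: "d = u + k + 2" and x: "\<forall>(a, b)\<in>S. (a < u \<longrightarrow> b \<le> u) \<and>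
            (a < u \<and> b = u \<longrightarrow> c (a, b) = x) \<and> (a = u \<and> u < b \<longrightarrow> c (a, b) = (\<not> x))"
          using frontier unfolding Rise b frontier.simps by (elim conjE exE) (rule that)
        have "c (a, b) = (\<not> x)" if "(a, b) \<in> S" "Suc u \<le> b" for a b
          using below[OF that(1)] bspec[OF x that(1)] that(2) by (cases "a = u") auto
        with d show ?thesis by (rule that)
      qed
      then show ?thesis
        by (intro ext[of "\<not> x"]) (use Rise 2 top in \<open>auto intro!: exI[of _ x]\<close>)
    qed (use 2 alive frontier level in auto)
  next
    case 3
    then have [simp]: "u' = Suc u" "d' = d" by (auto simp: u'_def d'_def)
    \<comment> \<open>The new interval is the single point d and is crossed by nothing, so its
      colour is arbitrary.\<close>
    have to_Joined: ?thesis if "next_state q st = Joined" "d = Suc u" "\<And>a b. (a, b) \<in> S \<Longrightarrow> b = d \<Longrightarrow> c (a, b) = x" for x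
      by (rule ext[of "\<not> x"]) (use that(1,2) top in \<open>auto simp: that(3) intro!: exI[of _ x]\<close>)
    show ?thesis
    proof (cases q)
      case First
      then have *: "d = Suc u" "\<And>a b. (a, b) \<in> S \<Longrightarrow> a < u \<Longrightarrow> b < u" using frontier by auto
      have "c (a, b) = c (u, d)" if "(a, b) \<in> S" "b = d" for a b
        using below[OF that(1)] *(2)[OF that(1)] that * by (cases "a = u") auto
      then show ?thesis using to_Joined First 3 * by auto
    next
      case Next
      obtain x where d: "d = Suc u" and x: "\<forall>(a, b)\<in>S. (b = u \<and> a < u \<longrightarrow> c (a, b) = x) \<and>
          (b = Suc u \<longrightarrow> a = u \<and> c (a, b) = (\<not> x))"
        using frontier unfolding Next frontier.simps by (elim conjE exE) (rule that)
      have "c (a, b) = (\<not> x)" if "(a, b) \<in> S" "b = d" for a b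
        using bspec[OF x that(1)] that(2) d by auto
      then show ?thesis using to_Joined[of "\<not> x"] Next 3 d by auto
    next
      case (Fall b k)
      show ?thesis
      proof (cases b)
        case True
        then have b: "b = True" by simp
        obtain x where d: "d = u + k + 1" and x: "\<forall>(a, b)\<in>S. (u \<le> b \<and> b < d \<longrightarrow> c (a, b) = x) \<and> (b = d \<longrightarrow> c (a, b) = (\<not> x))"
          using frontier unfolding Fall b frontier.simps by (elim conjE exE) (rule that)
        have x1: "c (a, b) = (\<not> x)" if "(a, b) \<in> S" "b = d" for a b
          using bspec[OF x that(1)] that(2) by auto
        have x2: "c (a, b) = x" if "(a, b) \<in> S" "u \<le> b" "b < d" for a b
          using bspec[OF x that(1)] that(2,3) by auto
        show ?thesis
        proof (cases k)
          case 0
          then show ?thesis using to_Joined[of "\<not> x"] x1 Fall True 3 d by auto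
        next
          case (Suc j)
          show ?thesis
            by (rule ext[of "\<not> x"]) (use Fall True Suc 3 d x1[OF _ refl] x2 in \<open>auto intro!: exI[of _ x] split: if_splits\<close>)
        qed
      next
        case False
        then have b: "b = False" by simp
        obtain x where d: "d = u + k + 1" and x: "\<forall>(a, b)\<in>S. u \<le> b \<and> b < d \<longrightarrow> c (a, b) = x"
          using frontier unfolding Fall b frontier.simps by (elim conjE exE) (rule that)
        have x2: "c (a, b) = x" if "(a, b) \<in> S" "u \<le> b" "b < d" for a b
          using bspec[OF x that(1)] that(2,3) by auto
        then show ?thesis
          by (intro ext[of "\<not> x"]; cases k) (use Fall False 3 d in \<open>auto intro!: exI[of _ x]\<close>)
      qed
    next
      case (Rise b k)
      show ?thesis
      proof (cases b)
        case False
        then have b: "b = False" by simp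
        obtain x where d: "d = u + k + 2" and x: "\<forall>(a, b)\<in>S. (a < u \<longrightarrow> b \<le> u) \<and>
            (a < u \<and> b = u \<longrightarrow> c (a, b) = x) \<and> (a = u \<and> u < b \<longrightarrow> c (a, b) = (\<not> x))"
          using frontier unfolding Rise b frontier.simps by (elim conjE exE) (rule that)
        have x1: "c (a, b) = (\<not> x)" if "(a, b) \<in> S" "Suc u \<le> b" for a b
          using below[OF that(1)] bspec[OF x that(1)] that(2) by (cases "a = u") auto
        then show ?thesis
          by (intro ext[of x]) (use Rise False 3 d in \<open>auto intro!: exI[of _ "\<not> x"]\<close>)
      next
        case True
        then have b: "b = True" by simp
        obtain x where d: "d = u + k + 2" and x: "\<forall>(a, b)\<in>S. (a < u \<longrightarrow> b < u) \<and> (a = u \<and> u < b \<longrightarrow> c (a, b) = x)"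
          using frontier unfolding Rise b frontier.simps by (elim conjE exE) (rule that)
        \<comment> \<open>The topmost interval of the rise crosses nothing yet, so it can be recoloured to
          agree with the intervals of the fall.\<close>
        define c1 where "c1 = c((u, d) := \<not> x)"
        have isolated: "\<not> crossing (u, d) p" "\<not> crossing p (u, d)" if "p \<in> S" for p
          using below[of "fst p" "snd p"] bspec[OF x that] that by (auto simp: crossing_def)
        have P1: "proper_colouring c1 S"
          using P isolated by (auto simp: proper_colouring_def c1_def)
        have x1: "c1 (a, b) = x" if "(a, b) \<in> S" "Suc u \<le> b" "b < d" for a b
          using below[OF that(1)] bspec[OF x that(1)] that(2,3) by (cases "a = u") (auto simp: c1_def)
        have x2: "c1 (a, b) = (\<not> x)" if "(a, b) \<in> S" "b = d" for a b
          using below[OF that(1)] bspec[OF x that(1)] that(2) d by (cases "a = u") (auto simp: c1_def)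
        have "proper_colouring (c1((u', d') := \<not> x)) (insert (u', d') S)"
          using proper_colouring_insert[OF P1 le new] x1 by auto
        moreover have "frontier (next_state q st) (c1((u', d') := \<not> x)) (insert (u', d') S) u' d'"
          using Rise True 3 d x1 x2[OF _ refl] by (auto intro!: exI[of _ x] split: if_splits)
        ultimately show ?thesis by blast
      qed
    qed (use 3 alive in auto)
  qed
qed

lemma foldl_next_state_Dead: "foldl next_state Dead w = Dead"
proof (induction w)
  case (Cons st w)
  then show ?case by (cases st rule: step_cases) simp_all
qed simp

lemma next_state_not_Dead:
  assumes "final (foldl next_state Fresh w)" "i < length w"
  shows "next_state (foldl next_state Fresh (take i w)) (w ! i) \<noteq> Dead"
proof -
  have "foldl next_state Fresh w = foldl next_state (foldl next_state Fresh (take (Suc i) w)) (drop (Suc i) w)"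
    by (metis append_take_drop_id foldl_append)
  then have "foldl next_state Fresh (take (Suc i) w) \<noteq> Dead"
    using assms(1) foldl_next_state_Dead by auto
  then show ?thesis using assms(2) by (simp add: take_Suc_conv_app_nth)
qed

fun height :: "state \<Rightarrow> nat" where
  "height First = 1"
| "height Next = 1"
| "height (Rise b k) = k + 2"
| "height (Fall b k) = k + 1"
| "height _ = 0"

lemma height_next_state:
  "next_state q st \<noteq> Dead \<Longrightarrow> height (next_state q st) + of_bool (fst st) = height q + of_bool (snd st)"
  by (induction q st rule: next_state.induct) simp_all

text \<open>As long as the run avoids \<open>Dead\<close>, d - u equals the height of the state, a
  natural number; final states have height 0.\<close>

lemma valid_word_if_final:
  assumes "final (foldl next_state Fresh w)"
  shows "valid_word w"
proof -
  have "ups w i + height (foldl next_state Fresh (take i w)) = downs w i" if "i \<le> length w" for i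
    using that
  proof (induction i)
    case (Suc i)
    then show ?case
      using height_next_state[OF next_state_not_Dead[OF assms, of i]]
      by (simp add: take_Suc_conv_app_nth ups_Suc downs_Suc)
  qed simp
  from this this[of "length w"] show ?thesis
    using assms by (cases "foldl next_state Fresh w") (fastforce simp: valid_word_def dest!: sym[of _ "downs w _"])+
qed

lemma proper_if_final:
  assumes "final (foldl next_state Fresh w)"
  shows "\<exists>c. proper_colouring c (points w (length w))"
proof -
  note v = valid_word_if_final[OF assms]
  have "\<exists>c. proper_colouring c (points w i) \<and> frontier (foldl next_state Fresh (take i w)) c (points w i) (ups w i) (downs w i)"
    if "i \<le> length w" for i
    using that
  proof (induction i)
    case 0
    then show ?case by (auto simp: points_def proper_colouring_def crossing_def)
  next
    case (Suc i)
    then obtain c where c: "proper_colouring c (points w i)"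
      "frontier (foldl next_state Fresh (take i w)) c (points w i) (ups w i) (downs w i)" by auto
    have i: "i < length w" using Suc by simp
    have eq: "points w (Suc i) = insert (ups w (Suc i), downs w (Suc i)) (points w i)"
      by (auto simp: points_def atMost_Suc)
    note alive = next_state_not_Dead[OF assms i]
    have below: "a \<le> ups w i \<and> b \<le> downs w i \<and> a \<le> b" if "(a, b) \<in> points w i" for a b
      using that v i by (auto simp: points_def ups_mono downs_mono valid_word_def)
    have cur: "(ups w i, downs w i) \<in> points w i" by (auto simp: points_def)
    show ?case
      using frontier_next_state[OF c(1) below cur c(2) alive] i
      unfolding eq by (simp add: take_Suc_conv_app_nth ups_Suc downs_Suc)
  qed
  then show ?thesis by blast
qed

section \<open>Counting accepted words\<close>

definition accepted :: "state \<Rightarrow> nat \<Rightarrow> step list set" where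
  "accepted q n = {w. length w = n \<and> final (foldl next_state q w)}"

section \<open>Generating functions of the states\<close>

definition gf :: "state \<Rightarrow> rat fps" where
  "gf q = Abs_fps (\<lambda>n. of_nat (card (accepted q n)))"

lemma finite_accepted [simp]: "finite (accepted q n)"
  by (rule finite_subset[OF _ finite_lists_length_eq[of UNIV n]]) (auto simp: accepted_def)

lemma accepted_0: "accepted q 0 = (if final q then {[]} else {})"
  by (auto simp: accepted_def)

lemma accepted_Suc: "accepted q (Suc n) = (\<Union>st\<in>UNIV. (#) st ` accepted (next_state q st) n)"
  unfolding accepted_def by (force simp: length_Suc_conv image_iff)

lemma card_accepted_Suc: "card (accepted q (Suc n)) = (\<Sum>st\<in>UNIV. card (accepted (next_state q st) n))"
  unfolding accepted_Suc
  by (subst card_UN_disjoint) (auto simp: card_image)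

lemma gf_eq: "gf q = (if final q then 1 else 0) + fps_X * (\<Sum>st\<in>UNIV. gf (next_state q st))"
proof (rule fps_ext)
  fix n
  show "fps_nth (gf q) n = fps_nth ((if final q then 1 else 0) + fps_X * (\<Sum>st\<in>UNIV. gf (next_state q st))) n"
    by (cases n) (auto simp: gf_def accepted_0 card_accepted_Suc fps_sum_nth)
qed

lemma UNIV_step: "(UNIV :: step set) = {(False, False), (False, True), (True, True), (True, False)}"
  by auto

lemma gf_Dead [simp]: "gf Dead = 0"
  by (auto simp: gf_def accepted_def foldl_next_state_Dead fps_eq_iff)

lemma gf_unfold:
  "gf q = (if final q then 1 else 0) +
     fps_X * (gf (next_state q (False, False)) + gf (next_state q (False, True)) +
       gf (next_state q (True, True)) + gf (next_state q (True, False)))"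
  by (subst gf_eq) (simp add: UNIV_step add.assoc)

text \<open>Uniqueness for the infinite system of the \<open>Rise\<close> states: since 1 - X is a
  unit, iterating shows that every power of X divides \<open>e k\<close>.\<close>

lemma iterate_X_zero:
  fixes e :: "nat \<Rightarrow> 'a :: idom fps"
  assumes "\<And>k. (1 - fps_X)\<^sup>2 * e k = fps_X * e (Suc k)"
  shows "e k = 0"
proof (rule ccontr)
  assume nz: "e k \<noteq> 0"
  have iter: "((1 - fps_X)\<^sup>2) ^ m * e k = fps_X ^ m * e (k + m)" for m
  proof (induction m)
    case (Suc m)
    have "((1 - fps_X)\<^sup>2) ^ Suc m * e k = (1 - fps_X)\<^sup>2 * (((1 - fps_X)\<^sup>2) ^ m * e k)"
      by (simp only: power_Suc mult.assoc)
    also have "\<dots> = fps_X ^ m * ((1 - fps_X)\<^sup>2 * e (k + m))"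
      by (simp only: Suc mult.left_commute)
    also have "\<dots> = fps_X ^ Suc m * e (k + Suc m)"
      by (simp only: assms power_Suc2 mult.assoc add_Suc_right)
    finally show ?case .
  qed simp
  have unit: "fps_nth (((1 - fps_X)\<^sup>2) ^ m) 0 = (1 :: 'a)" for m
    by (simp add: fps_power_zeroth)
  define m where "m = Suc (subdegree (e k))"
  have "fps_nth (((1 - fps_X)\<^sup>2) ^ m * e k) (subdegree (e k)) = fps_nth (e k) (subdegree (e k))"
    by (simp add: unit)
  moreover have "fps_nth (fps_X ^ m * e (k + m)) (subdegree (e k)) = 0"
    by (simp add: m_def fps_X_power_mult_nth del: power_Suc)
  ultimately show False using nz iter[of m] by simp
qed

section \<open>Eliminating the counter\<close>

lemma gf_Fall_Suc: "(1 - fps_X) * gf (Fall b (Suc k)) = fps_X * gf (Fall b k)"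
proof -
  have "gf (Fall b (Suc k)) = fps_X * (gf (Fall b (Suc k)) + gf (Fall b k))"
    using gf_unfold[of "Fall b (Suc k)"] by simp
  then show ?thesis by (simp add: algebra_simps)
qed

lemma gf_Fall: "(1 - fps_X) ^ k * gf (Fall b k) = fps_X ^ k * gf (Fall b 0)"
proof (induction k)
  case (Suc k)
  have "(1 - fps_X) ^ Suc k * gf (Fall b (Suc k)) = (1 - fps_X) ^ k * ((1 - fps_X) * gf (Fall b (Suc k)))"
    by (simp only: power_Suc2 mult.assoc)
  also have "\<dots> = fps_X * ((1 - fps_X) ^ k * gf (Fall b k))"
    by (simp only: gf_Fall_Suc mult.left_commute)
  finally show ?case by (simp only: Suc power_Suc mult.assoc)
qed simp

lemma gf_Rise_step:
  "(1 - fps_X) * gf (Rise b k) = fps_X * (gf (Rise b (Suc k)) + gf (Fall True (Suc k)) + gf (Fall b k))"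
proof -
  have "gf (Rise b k) = fps_X * (gf (Rise b k) + gf (Rise b (Suc k)) + gf (Fall True (Suc k)) + gf (Fall b k))"
    using gf_unfold[of "Rise b k"] by simp
  then show ?thesis by (simp add: algebra_simps)
qed

lemma gf_Rise:
  "(1 - 2 * fps_X) * gf (Rise b 0) = fps_X\<^sup>2 * gf (Fall True 0) + fps_X * (1 - fps_X) * gf (Fall b 0)"
proof -
  define a :: "rat fps" where "a = 1 - fps_X"
  \<comment> \<open>The difference between \<open>gf (Rise b k)\<close> and its closed form, with
    denominators cleared.\<close>
  define e where "e k = (1 - 2 * fps_X) * a ^ k * gf (Rise b k) -
    (fps_X ^ (k + 2) * gf (Fall True 0) + fps_X ^ Suc k * a * gf (Fall b 0))" for k
  have "(1 - fps_X)\<^sup>2 * e k = fps_X * e (Suc k)" for k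
  proof -
    have "a\<^sup>2 * ((1 - 2 * fps_X) * a ^ k * gf (Rise b k)) = (1 - 2 * fps_X) * a ^ Suc k * (a * gf (Rise b k))"
      by (simp add: power2_eq_square mult_ac)
    also have "\<dots> = fps_X * ((1 - 2 * fps_X) * a ^ Suc k * gf (Rise b (Suc k)))
       + (1 - 2 * fps_X) * fps_X * ((a ^ Suc k * gf (Fall True (Suc k))) + a * (a ^ k * gf (Fall b k)))"
      unfolding a_def gf_Rise_step by (simp add: algebra_simps)
    also have "\<dots> = fps_X * ((1 - 2 * fps_X) * a ^ Suc k * gf (Rise b (Suc k)))
       + (1 - 2 * fps_X) * fps_X * ((fps_X ^ Suc k * gf (Fall True 0)) + a * (fps_X ^ k * gf (Fall b 0)))"
      unfolding a_def gf_Fall ..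
    finally have R: "a\<^sup>2 * ((1 - 2 * fps_X) * a ^ k * gf (Rise b k)) = \<dots>" .
    \<comment> \<open>This identity is why the closed form solves the recursion: its first term
      gains a factor X / (1 - X) when k increases.\<close>
    have eq: "1 - 2 * fps_X = a\<^sup>2 - fps_X\<^sup>2" by (simp add: a_def power2_eq_square algebra_simps)
    have "a\<^sup>2 * e k = fps_X * e (Suc k)"
      unfolding e_def right_diff_distrib R unfolding eq by (simp add: algebra_simps power2_eq_square)
    then show ?thesis by (simp add: a_def)
  qed
  then have "e 0 = 0" by (rule iterate_X_zero)
  then show ?thesis by (simp add: e_def a_def numeral_2_eq_2)
qed

text \<open>The unknowns stand for \<open>Fresh\<close> (F), \<open>Joined\<close> (J),
  \<open>Closed\<close> (C), \<open>First\<close> (P), \<open>Next\<close> (Q),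
  \<open>Rise True 0\<close> (RT), \<open>Rise False 0\<close> (RF), \<open>Fall True 0\<close> (T)
  and \<open>Fall False 0\<close> (Y). First Q, then P is expressed through F; the abbreviations
  keep the intermediate polynomials small.\<close>

lemma linear_system:
  fixes x F :: "'a :: idom"
  assumes F: "(1 - 2 * x) * F = 1 + x * P"
    and J: "(1 - x) * J = 1 + x * (Q + F)"
    and C: "(1 - x) * C = 1 + x * F"
    and P: "(1 - x) * P = x * (RT + Q + J)"
    and Q: "(1 - 2 * x) * Q = x * (RF + J)"
    and RT: "(1 - 2 * x) * RT = x * T"
    and RF: "(1 - 2 * x) * RF = x\<^sup>2 * T + x * (1 - x) * Y"
    and T: "(1 - x) * T = x * (Q + J)"
    and Y: "(1 - x) * Y = x * C"
    and nz: "x \<noteq> 1"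
  shows "F * (7 * x ^ 8 - 66 * x ^ 7 + 197 * x ^ 6 - 311 * x ^ 5 + 294 * x ^ 4 - 172 * x ^ 3 + 61 * x ^ 2 - 12 * x + 1)
    = - 5 * x ^ 7 + 41 * x ^ 6 - 101 * x ^ 5 + 129 * x ^ 4 - 96 * x ^ 3 + 42 * x ^ 2 - 10 * x + 1"
proof -
  define a where "a = 1 - x"
  define b where "b = 1 - 2 * x"
  define M where "M = x\<^sup>2 + a * b"
  define K where "K = (a * b)\<^sup>2 - x\<^sup>2 * (a * b) - x ^ 4"
  have ax: "a + x = 1" by (simp add: a_def)
  note F = F[folded a_def b_def] and J = J[folded a_def b_def] and C = C[folded a_def b_def]
    and P = P[folded a_def b_def] and Q = Q[folded a_def b_def] and RT = RT[folded a_def b_def]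
    and RF = RF[folded a_def b_def] and T = T[folded a_def b_def] and Y = Y[folded a_def b_def]
  have Q1: "a * b\<^sup>2 * Q = x * (x ^ 3 * (Q + J) + x\<^sup>2 * (1 + x * F) + a * b * J)"
    using Q RF T Y C by algebra
  have Q2: "Q * K = x * (1 + x * F) * M"
    using Q1 J ax unfolding K_def M_def by algebra
  have "a\<^sup>2 * b * (x * P) = x\<^sup>2 * M * (Q + J)"
    using P RT T unfolding M_def by algebra
  then have "a ^ 3 * b * (x * P) = x\<^sup>2 * M * (Q + (1 + x * F))"
    using J ax by algebra
  \<comment> \<open>Since x * P = b * F - 1, multiplying by K and inserting \<open>Q2\<close> leaves
    an equation in F alone. It contains a spare factor 1 - x, cancelled at the end.\<close>
  then have "a ^ 3 * b * (b * F - 1) * K = x\<^sup>2 * M * (1 + x * F) * (x * M + K)"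
    using Q2 F by algebra
  then have "(1 - x) * (F * (7 * x ^ 8 - 66 * x ^ 7 + 197 * x ^ 6 - 311 * x ^ 5 + 294 * x ^ 4 - 172 * x ^ 3 + 61 * x ^ 2 - 12 * x + 1))
    = (1 - x) * (- 5 * x ^ 7 + 41 * x ^ 6 - 101 * x ^ 5 + 129 * x ^ 4 - 96 * x ^ 3 + 42 * x ^ 2 - 10 * x + 1)"
    unfolding a_def b_def M_def K_def by algebra
  then show ?thesis using nz by simp
qed

lemma gf_Fresh:
  "gf Fresh * (7 * fps_X ^ 8 - 66 * fps_X ^ 7 + 197 * fps_X ^ 6 - 311 * fps_X ^ 5 + 294 * fps_X ^ 4
      - 172 * fps_X ^ 3 + 61 * fps_X ^ 2 - 12 * fps_X + 1)
   = - 5 * fps_X ^ 7 + 41 * fps_X ^ 6 - 101 * fps_X ^ 5 + 129 * fps_X ^ 4 - 96 * fps_X ^ 3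
      + 42 * fps_X ^ 2 - 10 * fps_X + 1"
proof (rule linear_system)
  show "(1 - 2 * fps_X) * gf Fresh = 1 + fps_X * gf First"
    using gf_unfold[of Fresh] by (simp add: algebra_simps)
  show "(1 - fps_X) * gf Joined = 1 + fps_X * (gf Next + gf Fresh)"
    using gf_unfold[of Joined] by (simp add: algebra_simps)
  show "(1 - fps_X) * gf Closed = 1 + fps_X * gf Fresh"
    using gf_unfold[of Closed] by (simp add: algebra_simps)
  show "(1 - fps_X) * gf First = fps_X * (gf (Rise True 0) + gf Next + gf Joined)"
    using gf_unfold[of First] by (simp add: algebra_simps)
  show "(1 - 2 * fps_X) * gf Next = fps_X * (gf (Rise False 0) + gf Joined)"
    using gf_unfold[of Next] by (simp add: algebra_simps)
  show "(1 - fps_X) * gf (Fall True 0) = fps_X * (gf Next + gf Joined)"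
    using gf_unfold[of "Fall True 0"] by (simp add: algebra_simps)
  show "(1 - fps_X) * gf (Fall False 0) = fps_X * gf Closed"
    using gf_unfold[of "Fall False 0"] by (simp add: algebra_simps)
  \<comment> \<open>For b = True both terms of \<open>gf_Rise\<close> involve the same series, and
    X^2 + X (1 - X) = X.\<close>
  show "(1 - 2 * fps_X) * gf (Rise True 0) = fps_X * gf (Fall True 0)"
    using gf_Rise[of True] by (simp add: algebra_simps power2_eq_square)
  show "(1 - 2 * fps_X) * gf (Rise False 0) = fps_X\<^sup>2 * gf (Fall True 0) + fps_X * (1 - fps_X) * gf (Fall False 0)"
    by (rule gf_Rise)
  show "fps_X \<noteq> (1 :: rat fps)"
    by (metis fps_X_neq_one)
qed

section \<open>Isomorphism classes and the generating function\<close>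

lemma poset_isomorphic_refl: "poset_isomorphic X r X r"
  unfolding poset_isomorphic_def by (intro exI[of _ id]) auto

lemma poset_isomorphic_sym:
  assumes "poset_isomorphic X r Y s"
  shows "poset_isomorphic Y s X r"
proof -
  obtain f where f: "bij_betw f X Y" "\<And>x y. x \<in> X \<Longrightarrow> y \<in> X \<Longrightarrow> (x, y) \<in> r \<longleftrightarrow> (f x, f y) \<in> s"
    using assms by (auto simp: poset_isomorphic_def)
  have inv: "inv_into X f y \<in> X \<and> f (inv_into X f y) = y" if "y \<in> Y" for y
    using bij_betw_inv_into_right[OF f(1) that] bij_betw_apply[OF bij_betw_inv_into[OF f(1)] that] by blast
  show ?thesis
    unfolding poset_isomorphic_def
    using f(2) inv bij_betw_inv_into[OF f(1)] by (intro exI[of _ "inv_into X f"]) metis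
qed

lemma poset_isomorphic_trans:
  assumes "poset_isomorphic X r Y s" "poset_isomorphic Y s Z t"
  shows "poset_isomorphic X r Z t"
proof -
  obtain f where f: "bij_betw f X Y" "\<And>x y. x \<in> X \<Longrightarrow> y \<in> X \<Longrightarrow> (x, y) \<in> r \<longleftrightarrow> (f x, f y) \<in> s"
    using assms by (auto simp: poset_isomorphic_def)
  obtain g where g: "bij_betw g Y Z" "\<And>x y. x \<in> Y \<Longrightarrow> y \<in> Y \<Longrightarrow> (x, y) \<in> s \<longleftrightarrow> (g x, g y) \<in> t"
    using assms by (auto simp: poset_isomorphic_def)
  show ?thesis
    unfolding poset_isomorphic_def
    using bij_betw_trans[OF f(1) g(1)] f(2) g(2) bij_betw_apply[OF f(1)]
    by (intro exI[of _ "g \<circ> f"]) simp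
qed

lemma equiv_iso_rel: "equiv (semiorders_dim_le_2 n) (iso_rel n)"
  unfolding equiv_def refl_on_def sym_def trans_def iso_rel_def
  by (auto intro: poset_isomorphic_refl poset_isomorphic_sym poset_isomorphic_trans)

lemma word_order_in_semiorders_dim_le_2:
  assumes "w \<in> accepted Fresh m"
  shows "word_order w \<in> semiorders_dim_le_2 (Suc m)"
proof -
  have fin: "final (foldl next_state Fresh w)" and len: "length w = m" using assms by (auto simp: accepted_def)
  have v: "valid_word w" by (rule valid_word_if_final[OF fin])
  obtain c where "proper_colouring c (points w (length w))" using proper_if_final[OF fin] by blast
  then have "poset_dim {..length w} (word_order w) \<le> 2"
    unfolding word_order_def points_def
    by (intro proper_imp_poset_dim_le_2[where c = c]) (use v in \<open>auto simp: valid_word_def\<close>)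
  then show ?thesis
    using semiorder_word_order[OF v] len by (simp add: semiorders_dim_le_2_def lessThan_Suc_atMost)
qed

lemma semiorder_dim_le_2_imp_accepted:
  assumes "r \<in> semiorders_dim_le_2 (Suc m)"
  shows "\<exists>w\<in>accepted Fresh m. poset_isomorphic {..m} r {..m} (word_order w)"
proof -
  have semi: "semiorder {..m} r" and dim: "poset_dim {..m} r \<le> 2"
    using assms by (auto simp: semiorders_dim_le_2_def lessThan_Suc_atMost)
  obtain w p where w: "valid_word w" "length w = m" and p: "bij_betw p {..m} {..m}"
    and r: "r = interval_order {..m} (ups w \<circ> p) (downs w \<circ> p)"
    using semiorder_imp_word[OF semi, of m] by auto
  have pim: "p ` {..m} = {..m}" using p by (simp add: bij_betw_def)
  \<comment> \<open>Both ends start at 0, finish at the same value and skip nothing in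
    between.\<close>
  have "ups w ` {..m} = downs w ` {..m}"
  proof -
    have last: "ups w m = downs w m" using w by (simp add: valid_word_def)
    show ?thesis
    proof (intro equalityI image_subsetI)
      fix i assume "i \<in> {..m}"
      then have "ups w i \<le> downs w m" "downs w i \<le> ups w m"
        using ups_mono[of i m w] downs_mono[of i m w] last by auto
      then show "ups w i \<in> downs w ` {..m}" "downs w i \<in> ups w ` {..m}"
        using downs_attains[of _ w m] ups_attains[of _ w m] w(2) by (force simp: image_iff)+
    qed
  qed
  then have img: "(ups w \<circ> p) ` {..m} = (downs w \<circ> p) ` {..m}"
    by (simp only: image_comp[symmetric] pim)
  have "(ups w \<circ> p) x \<le> (downs w \<circ> p) x" if "x \<in> {..m}" for x
    using w bij_betw_apply[OF p that] by (simp add: valid_word_def)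
  from poset_dim_le_2_imp_proper[OF _ this img] dim
  obtain c where "proper_colouring c ((\<lambda>x. ((ups w \<circ> p) x, (downs w \<circ> p) x)) ` {..m})" by (auto simp: r)
  moreover have "(\<lambda>x. ((ups w \<circ> p) x, (downs w \<circ> p) x)) ` {..m} = points w (length w)"
    unfolding points_def w(2) by (subst (2) pim[symmetric]) (simp add: image_image)
  ultimately have "final (foldl next_state Fresh w)" using final_if_proper[OF w(1)] by metis
  then have "w \<in> accepted Fresh m" using w by (simp add: accepted_def)
  moreover have "poset_isomorphic {..m} r {..m} (word_order w)"
    unfolding poset_isomorphic_def
  proof (intro exI[of _ p] conjI ballI)
    fix x y assume xy: "x \<in> {..m}" "y \<in> {..m}"
    then have "p x = p y \<longleftrightarrow> x = y" "p x \<in> {..m}" "p y \<in> {..m}"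
      using p bij_betw_apply[OF p] by (auto simp: bij_betw_def inj_on_eq_iff)
    then show "(x, y) \<in> r \<longleftrightarrow> (p x, p y) \<in> word_order w"
      using xy by (auto simp: r word_order_def interval_order_def w(2))
  qed (rule p)
  ultimately show ?thesis by blast
qed

text \<open>Each isomorphism class contains \<open>word_order w\<close> for exactly one accepted
  word; a word of m steps has m + 1 points, one before each step and one at the end.\<close>

lemma num_semiorders_dim_le_2_Suc: "num_semiorders_dim_le_2 (Suc m) = card (accepted Fresh m)"
proof -
  let ?S = "semiorders_dim_le_2 (Suc m)" and ?E = "iso_rel (Suc m)" and ?W = "accepted Fresh m"
  note in_S = word_order_in_semiorders_dim_le_2
  have iso: "(r, s) \<in> ?E \<longleftrightarrow> r \<in> ?S \<and> s \<in> ?S \<and> poset_isomorphic {..m} r {..m} s" for r s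
    by (simp add: iso_rel_def lessThan_Suc_atMost)
  have "bij_betw (\<lambda>w. ?E `` {word_order w}) ?W (?S // ?E)"
    unfolding bij_betw_def
  proof (intro conjI inj_onI equalityI subsetI)
    fix w w' assume w: "w \<in> ?W" "w' \<in> ?W" and "?E `` {word_order w} = ?E `` {word_order w'}"
    then have "(word_order w, word_order w') \<in> ?E"
      using eq_equiv_class[OF _ equiv_iso_rel in_S[OF w(2)]] by blast
    then show "w = w'"
      using isomorphic_word_orders[of w w' m] w valid_word_if_final by (auto simp: iso accepted_def)
  next
    fix A assume "A \<in> (\<lambda>w. ?E `` {word_order w}) ` ?W"
    then show "A \<in> ?S // ?E" using in_S by (auto intro: quotientI)
  next
    fix A assume "A \<in> ?S // ?E"
    then obtain r where r: "r \<in> ?S" "A = ?E `` {r}" by (auto elim: quotientE)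
    then obtain w where w: "w \<in> ?W" "poset_isomorphic {..m} r {..m} (word_order w)"
      using semiorder_dim_le_2_imp_accepted by blast
    then have "A = ?E `` {word_order w}"
      using r in_S by (auto simp: iso intro!: equiv_class_eq[OF equiv_iso_rel])
    then show "A \<in> (\<lambda>w. ?E `` {word_order w}) ` ?W" using w by blast
  qed
  then show ?thesis unfolding num_semiorders_dim_le_2_def by (simp add: bij_betw_same_card)
qed

lemma D_series_eq: "D_series = fps_X * gf Fresh"
proof (rule fps_ext)
  fix n
  show "fps_nth D_series n = fps_nth (fps_X * gf Fresh) n"
    by (cases n) (auto simp: D_series_def gf_def num_semiorders_dim_le_2_Suc)
qed

theorem theorem5p1:
  shows "D_series =
    (- 5 * fps_X ^ 8 + 41 * fps_X ^ 7 - 101 * fps_X ^ 6 + 129 * fps_X ^ 5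
       - 96 * fps_X ^ 4 + 42 * fps_X ^ 3 - 10 * fps_X ^ 2 + fps_X) /
    (7 * fps_X ^ 8 - 66 * fps_X ^ 7 + 197 * fps_X ^ 6 - 311 * fps_X ^ 5
       + 294 * fps_X ^ 4 - 172 * fps_X ^ 3 + 61 * fps_X ^ 2 - 12 * fps_X + 1)"
  (is "_ = ?N / ?Q")
proof -
  have "D_series * ?Q = fps_X * (gf Fresh * ?Q)"
    by (simp only: D_series_eq mult.assoc)
  also have "\<dots> = ?N"
    unfolding gf_Fresh by algebra
  finally have "D_series * ?Q = ?N" .
  moreover have "fps_nth ?Q 0 = 1" by (simp add: fps_X_power_nth)
  then have "?Q \<noteq> 0" by (metis fps_zero_nth zero_neq_one)
  ultimately show ?thesis by (metis nonzero_mult_div_cancel_right)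
qed

end
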